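(* For every prime or prime power $q\ge 2$, there exist a full PAB$(2q,2,1)$ and a full PAB$(4q,4,3)$.
   Context: Block designs. A block design BD$(v,b,r,k)$ consists of a set $V$ of $v$ points and a family (repetitions allowed) of $b$ blocks, each block being a set of $k$ different points, such that each point lies in exactly $r$ blocks. Its incidence matrix is the $v\times b$ $(0,1)$-matrix whose $(i,j)$ entry is $1$ if and only if the $i$-th point lies in the $j$-th block. A BD$(v,b,r,k)$ is a balanced incomplete block (BIB) design BIBD$(v,b,r,k,\lambda)$ if any two different points lie together in exactly $\lambda$ blocks (the case $k=v$ is allowed). The parameters satisfy $vr=bk$ and $\lambda(v-1)=r(k-1)$, so for $k\ge2$ the values $r=\lambda(v-1)/(k-1)$ and $b=vr/k$ are determined by $v,k,\lambda$. Pairwise additive BIB designs. A PAB$(\ell;v,k,\lambda)$ is a set of $\ell$ matrices $N_1,\dots,N_\ell$ of size $v\times b$, $N_h=(a^{(h)}_{ij})$, such that each $N_h$ is the incidence matrix of a BIBD$(v,b,r,k,\lambda)$, $a^{(h_1)}_{ij}a^{(h_2)}_{ij}=0$ for all $i,j$ and all distinct $h_1,h_2$, and for all distinct $h_1,h_2$ the matrix $N_{h_1}+N_{h_2}$ is the incidence matrix of a BIBD with parameters $(v,\,b,\,2r,\,2k,\,2r(2k-1)/(v-1))$. A full PAB$(v,k,\lambda)$ is a PAB$(\ell;v,k,\lambda)$ with $\ell=v/k$. *)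

theory Defs
  imports "Jordan_Normal_Form.Matrix" "HOL-Number_Theory.Prime_Powers"
begin

text \<open>The family of blocks is a list: repeated blocks are allowed, and the order of the list
  is the order of the columns of the incidence matrix.\<close>

definition block_design :: "'a set \<Rightarrow> 'a set list \<Rightarrow> nat \<Rightarrow> nat \<Rightarrow> nat \<Rightarrow> nat \<Rightarrow> bool" where
  "block_design V Bs v b r k \<longleftrightarrow>
     finite V \<and> card V = v \<and> length Bs = b \<and>
     (\<forall>B\<in>set Bs. B \<subseteq> V \<and> card B = k) \<and>
     (\<forall>x\<in>V. card {j. j < b \<and> x \<in> Bs ! j} = r)"

definition BIBD :: "'a set \<Rightarrow> 'a set list \<Rightarrow> nat \<Rightarrow> nat \<Rightarrow> nat \<Rightarrow> nat \<Rightarrow> nat \<Rightarrow> bool" where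
  "BIBD V Bs v b r k l \<longleftrightarrow>
     block_design V Bs v b r k \<and>
     (\<forall>x\<in>V. \<forall>y\<in>V. x \<noteq> y \<longrightarrow> card {j. j < b \<and> x \<in> Bs ! j \<and> y \<in> Bs ! j} = l)"

definition incidence_matrix :: "'a list \<Rightarrow> 'a set list \<Rightarrow> nat mat" where
  "incidence_matrix ps Bs =
     mat (length ps) (length Bs) (\<lambda>(i, j). if ps ! i \<in> Bs ! j then 1 else 0)"

text \<open>Only the matrix matters here, so it is no restriction that the points are natural
  numbers: any finite point set can be relabelled without changing the matrix.\<close>

definition BIBD_matrix :: "nat mat \<Rightarrow> nat \<Rightarrow> nat \<Rightarrow> nat \<Rightarrow> nat \<Rightarrow> nat \<Rightarrow> bool" where
  "BIBD_matrix N v b r k l \<longleftrightarrow>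
     (\<exists>(ps :: nat list) Bs. distinct ps \<and> BIBD (set ps) Bs v b r k l \<and> N = incidence_matrix ps Bs)"

text \<open>The parameters \<open>b\<close> and \<open>r\<close> are common to all matrices; for \<open>k \<ge> 2\<close> they are determined
  by \<open>v\<close>, \<open>k\<close> and \<open>l\<close>. The index of the pairwise sums is an exact quotient, which
  is why it is stated over the reals.\<close>

definition PAB :: "nat \<Rightarrow> nat \<Rightarrow> nat \<Rightarrow> nat \<Rightarrow> nat mat list \<Rightarrow> bool" where
  "PAB n v k l Ns \<longleftrightarrow>
     length Ns = n \<and>
     (\<exists>b r.
        (\<forall>h<n. BIBD_matrix (Ns ! h) v b r k l) \<and>
        (\<forall>h1<n. \<forall>h2<n. h1 \<noteq> h2 \<longrightarrow>
           (\<forall>i<v. \<forall>j<b. (Ns ! h1) $$ (i, j) * (Ns ! h2) $$ (i, j) = 0) \<and>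
           (\<exists>m. real m = 2 * real r * (2 * real k - 1) / (real v - 1) \<and>
                BIBD_matrix (Ns ! h1 + Ns ! h2) v b (2 * r) (2 * k) m)))"

definition full_PAB :: "nat \<Rightarrow> nat \<Rightarrow> nat \<Rightarrow> nat mat list \<Rightarrow> bool" where
  "full_PAB v k l Ns \<longleftrightarrow> (\<exists>n. real n = real v / real k \<and> PAB n v k l Ns)"

end

(* A generalized Hadamard matrix M over an abelian group G of order q, with k q rows and k q
   columns, yields a full PAB(k q, k, k - 1): drop one column j0, replace every other column j by
   its q translates, and label row i of the translate (j, g) by M i j - M i j0 + g. The h-th
   incidence matrix marks the entries labelled h. Two rows carry equal given labels k - 1 times
   and distinct given labels k times, so only the constancy of the block size remains, and that
   follows from its variance.

   If q is a power of 2, the multiplication table of the field of order k q, reduced modulo an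
   additive subgroup of order k, is such a matrix. If q is odd, rows (x, s) and columns (y, t) with
   entries (x - y)^2 / (a s + b t) work as soon as the quadratic characters of the a s + b t are
   balanced for any two rows s. For k = 4 and q > 5 such parameters come from the four 2-torsion
   translates on an elliptic curve in Legendre form; q = 3 and q = 5 are too small for this and
   are settled by explicit matrices. *)
theory Submission
  imports Defs "HOL-Algebra.Algebraic_Closure" "HOL-Algebra.Sylow" "HOL-Number_Theory.Residues"
begin

section \<open>Finite fields\<close>

text \<open>For \<open>k\<close> equal to 2 or 4, \<open>k * q\<close> is a prime power only if
  \<open>q\<close> is a power of 2. For odd \<open>q\<close> no field has as many elements as there
  are rows, which is why rows and columns become pairs of a field element and an index. In that
  matrix the condition on two rows is, within each block of \<open>q\<close> columns, an equation in
  the column element \<open>y\<close>. For rows with equal index it is linear and has one solution.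
  Otherwise it is quadratic and has \<open>1 + chi\<close> solutions, where \<open>chi\<close> is
  the quadratic character (zero at zero) of \<open>(a s + b t) (a s' + b t) w\<close>, with
  \<open>w\<close> common to all blocks and the first two factors replaced by 1 in block
  \<open>t = 0\<close>. The total is right for every \<open>w\<close> exactly when the signs of the
  \<open>a s + b t\<close>, bordered by a column of ones for \<open>t = 0\<close>, have orthogonal
  rows: the balance condition asks for an ordinary Hadamard matrix of order 2 or 4 made of
  characters. The small orders fail because parameters run out: \<open>x\<close> must avoid
  \<open>0, 1, l\<close>, which exhausts order 3, and for order 5 the values to be avoided by the
  auxiliary \<open>t\<close>, namely \<open>0\<close>, \<open>1\<close>, \<open>-1\<close> and the
  two roots of \<open>-1\<close>, are the whole field.\<close>

lemma (in cring) binomial_theorem: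
  assumes x: "x \<in> carrier R" and y: "y \<in> carrier R"
  shows "(x \<oplus> y) [^] (n::nat) = (\<Oplus>i\<in>{..n}. [(n choose i)] \<cdot> (x [^] i \<otimes> y [^] (n - i)))"
proof (induction n)
  case 0
  show ?case using x y by simp
next
  case (Suc n)
  define a where "a i = x [^] i \<otimes> y [^] (Suc n - i)" for i
  define S where "S = (\<Oplus>i\<in>{..n}. [(n choose i)] \<cdot> (x [^] i \<otimes> y [^] (n - i)))"
  have zn: "[(n choose Suc n)] \<cdot> a (Suc n) = \<zero>"
    unfolding binomial_eq_0[OF lessI] by (simp add: add_pow_def)
  have a: "a i \<in> carrier R" for i using x y by (simp add: a_def)
  have S: "S \<in> carrier R" using x y by (simp add: S_def)
  have "S \<otimes> x = (\<Oplus>i\<in>{..n}. [(n choose i)] \<cdot> a (Suc i))"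
    unfolding S_def using x y
    by (subst finsum_ldistr) (auto intro!: finsum_cong' simp: a_def add_pow_ldistr add_pow_rdistr m_ac)
  moreover have "S \<otimes> y = (\<Oplus>i\<in>{..Suc n}. [(n choose i)] \<cdot> a i)"
  proof -
    have "S \<otimes> y = (\<Oplus>i\<in>{..n}. [(n choose i)] \<cdot> a i)"
      unfolding S_def using x y
      by (subst finsum_ldistr) (auto intro!: finsum_cong' simp: a_def add_pow_ldistr add_pow_rdistr m_ac Suc_diff_le)
    also have "\<dots> = (\<Oplus>i\<in>{..Suc n}. [(n choose i)] \<cdot> a i)"
      using a zn by (subst finsum_Suc) auto
    finally show ?thesis .
  qed
  moreover have "(\<Oplus>i\<in>{..Suc n}. [(n choose i)] \<cdot> a i)
      = (\<Oplus>i\<in>{..n}. [(n choose Suc i)] \<cdot> a (Suc i)) \<oplus> a 0"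
    using a by (subst finsum_Suc2) auto
  ultimately have "S \<otimes> x \<oplus> S \<otimes> y = ((\<Oplus>i\<in>{..n}. [(n choose i)] \<cdot> a (Suc i))
      \<oplus> (\<Oplus>i\<in>{..n}. [(n choose Suc i)] \<cdot> a (Suc i))) \<oplus> a 0"
    using a by (simp add: a_assoc)
  also have "\<dots> = (\<Oplus>i\<in>{..n}. [(Suc n choose Suc i)] \<cdot> a (Suc i)) \<oplus> a 0"
    using a by (subst finsum_addf [symmetric]) (auto intro!: finsum_cong' simp: add.nat_pow_mult)
  also have "\<dots> = (\<Oplus>i\<in>{..Suc n}. [(Suc n choose i)] \<cdot> a i)"
    using a by (subst finsum_Suc2) auto
  finally have "S \<otimes> (x \<oplus> y) = (\<Oplus>i\<in>{..Suc n}. [(Suc n choose i)] \<cdot> a i)"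
    using S x y by (simp add: r_distr)
  then show ?case using Suc.IH S_def a_def by simp
qed

text \<open>The inner binomial coefficients are multiples of \<open>p\<close> and vanish in
  characteristic \<open>p\<close>; the case of exponent \<open>p\<close> is then iterated. It is
  applied both in the algebraically closed field and in its polynomial ring.\<close>

lemma (in cring) prime_power_add:
  assumes p: "Factorial_Ring.prime (p::nat)" and char: "[p] \<cdot> \<one> = \<zero>"
    and x: "x \<in> carrier R" and y: "y \<in> carrier R"
  shows "(x \<oplus> y) [^] (p ^ n) = x [^] (p ^ n) \<oplus> y [^] (p ^ n)"
proof (induction n)
  case 0
  show ?case using x y by simp
next
  case (Suc n)
  have *: "(u \<oplus> v) [^] p = u [^] p \<oplus> v [^] p" if u: "u \<in> carrier R" and v: "v \<in> carrier R" for u v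
  proof -
    define a where "a i = u [^] i \<otimes> v [^] (p - i)" for i
    have a: "a i \<in> carrier R" for i using u v by (simp add: a_def)
    have z: "[(p choose i)] \<cdot> a i = \<zero>" if "i \<noteq> 0" "i < p" for i
    proof -
      have "p dvd (p choose i)" using p that by (intro dvd_choose_prime) auto
      then obtain m where m: "p choose i = p * m" by blast
      have "[p] \<cdot> a i = [p] \<cdot> \<one> \<otimes> a i" using a by (subst add_pow_ldistr) auto
      then have "[p] \<cdot> a i = \<zero>" using a char by simp
      then show ?thesis using a[of i] by (simp add: m add.nat_pow_pow[symmetric])
    qed
    obtain k where k: "p = Suc k" "k \<noteq> 0" using p by (metis One_nat_def Suc_pred prime_gt_0_nat not_prime_1)
    have "(u \<oplus> v) [^] p = (\<Oplus>i\<in>{..p}. [(p choose i)] \<cdot> a i)"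
      using u v by (simp add: binomial_theorem a_def)
    also have "\<dots> = (\<Oplus>i\<in>{..p}. (if i = 0 then a 0 else \<zero>) \<oplus> (if i = p then a p else \<zero>))"
      using a z k by (intro finsum_cong') (auto simp del: binomial_Suc_Suc simp: le_less)
    also have "\<dots> = (\<Oplus>i\<in>{..p}. if i = 0 then a 0 else \<zero>) \<oplus> (\<Oplus>i\<in>{..p}. if i = p then a p else \<zero>)"
      using a by (intro finsum_addf) auto
    also have "(\<Oplus>i\<in>{..p}. if i = 0 then a 0 else \<zero>) = a 0"
      using a add.finprod_singleton[of 0 "{..p}" "\<lambda>_. a 0"] by (auto simp: eq_commute)
    also have "(\<Oplus>i\<in>{..p}. if i = p then a p else \<zero>) = a p"
      using a add.finprod_singleton[of p "{..p}" "\<lambda>_. a p"] by (auto simp: eq_commute)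
    finally show ?thesis using u v by (simp add: a_def a_comm)
  qed
  show ?case using Suc.IH x y by (simp add: mult.commute[of p] nat_pow_pow[symmetric] *)
qed

lemma (in ring_hom_ring) hom_nat_one: "h ([(m::nat)] \<cdot>\<^bsub>R\<^esub> \<one>\<^bsub>R\<^esub>) = [m] \<cdot>\<^bsub>S\<^esub> \<one>\<^bsub>S\<^esub>"
proof (induction m)
  case (Suc m)
  have "[m] \<cdot>\<^bsub>R\<^esub> \<one>\<^bsub>R\<^esub> \<in> carrier R" using R.add.nat_pow_closed[OF R.one_closed, of m] by (simp add: add_pow_def)
  from hom_add[OF this R.one_closed] Suc show ?case by (simp add: add_pow_def)
qed (simp add: add_pow_def)

text \<open>The polynomial \<open>X^q - X\<close> with \<open>q = p ^ n\<close> splits, so it has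
  \<open>q\<close> roots counted with multiplicity; what remains is that no root is double.\<close>

lemma (in algebraically_closed) card_fixed_power:
  assumes p: "Factorial_Ring.prime (p::nat)" and char: "[p] \<cdot> \<one> = \<zero>" and n: "n > 0"
  shows "card {x \<in> carrier L. x [^] (p ^ n) = x} = p ^ n"
proof -
  define q where "q = p ^ n"
  have q: "q \<ge> 2" using prime_ge_2_nat[OF p] n
    by (metis q_def One_nat_def Suc_leI le_trans power_increasing power_one_right prime_ge_1_nat p)
  define P where "P = poly_ring L"
  interpret UP: domain P
    unfolding P_def by (rule univ_poly_is_domain[OF carrier_is_subring])
  define f where "f = X [^]\<^bsub>P\<^esub> q \<ominus>\<^bsub>P\<^esub> X"
  have X: "X \<in> carrier P" unfolding P_def by (rule var_closed[OF carrier_is_subring])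
  have Xq: "X [^]\<^bsub>P\<^esub> q = monom \<one> q"
    unfolding P_def by (rule unitary_monom_eq_var_pow[OF carrier_is_subring, symmetric])
  have f: "f \<in> carrier P" using X by (simp add: f_def)
  have deg: "degree f = q"
  proof -
    have m: "\<ominus>\<^bsub>P\<^esub> X = map (\<lambda>a. \<ominus> a) X"
      using univ_poly_a_inv_def'[OF carrier_is_subring] X by (simp add: P_def)
    have dX: "degree (\<ominus>\<^bsub>P\<^esub> X) = 1" unfolding m by (simp add: var_def)
    have dm: "degree (monom \<one> q) = q" by (simp add: monom_def)
    have ne: "degree (monom \<one> q) \<noteq> degree (\<ominus>\<^bsub>P\<^esub> X)" unfolding dX dm using q by simp
    have "f = poly_add (monom \<one> q) (\<ominus>\<^bsub>P\<^esub> X)"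
      by (simp only: f_def a_minus_def Xq) (simp only: P_def univ_poly_add)
    moreover have "polynomial (carrier L) (\<ominus>\<^bsub>P\<^esub> X)"
      using UP.a_inv_closed[OF X] univ_poly_carrier unfolding P_def by blast
    moreover have "polynomial (carrier L) (monom \<one> q)"
      using UP.nat_pow_closed[OF X, of q] univ_poly_carrier unfolding P_def Xq[unfolded P_def] by blast
    ultimately have "degree f = max (degree (monom \<one> q)) (degree (\<ominus>\<^bsub>P\<^esub> X))"
      using poly_add_degree_eq[OF carrier_is_subring _ _ ne] by metis
    then show ?thesis unfolding dX dm using q by simp
  qed
  then have f0: "f \<noteq> []" using q by auto
  have ev: "ring_hom_ring P L (\<lambda>g. eval g a)" if "a \<in> carrier L" for a
    using eval_ring_hom[OF carrier_is_subring that] unfolding P_def .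
  have root: "is_root f a \<longleftrightarrow> a \<in> carrier L \<and> a [^] q = a" for a
  proof (cases "a \<in> carrier L")
    case True
    interpret h: ring_hom_ring P L "\<lambda>g. eval g a" by (rule ev[OF True])
    have "eval f a = a [^] q \<ominus> a"
      using X True by (simp add: f_def a_minus_def h.hom_nat_pow eval_var)
    then show ?thesis using True f0 by (simp add: is_root_def)
  qed (simp add: is_root_def)
  have mult: "alg_mult f a \<le> 1" for a
    \<comment> \<open>\<open>f = (X - a)\<^sup>q - (X - a)\<close>, so a double root would make \<open>X - a\<close> invertible\<close>
  proof (rule ccontr)
    assume "\<not> alg_mult f a \<le> 1"
    then have m2: "2 \<le> alg_mult f a" by simp
    then have "is_root f a"
      using alg_mult_gt_zero_iff_is_root[of f a] f unfolding P_def by linarith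
    then have a: "a \<in> carrier L" "a [^] q = a" using root by auto
    define b where "b = [\<one>, \<ominus> a]"
    define c where "c = poly_of_const a"
    have hom: "poly_of_const \<in> ring_hom L P"
      using canonical_embedding_is_hom[OF carrier_is_subring] unfolding P_def by simp
    interpret c: ring_hom_ring L P poly_of_const
      by (intro ring_hom_ringI2 hom) (simp_all add: ring_axioms UP.ring_axioms)
    have c: "c \<in> carrier P" "c [^]\<^bsub>P\<^esub> q = c"
      using a c.hom_nat_pow[of a q] by (auto simp: c_def)
    have b: "b \<in> carrier P"
      using a unfolding b_def P_def sym[OF univ_poly_carrier] polynomial_def by auto
    have bc: "X = b \<oplus>\<^bsub>P\<^esub> c"
      using a by (auto simp: P_def univ_poly_add b_def c_def poly_of_const_def var_def l_neg)
    have charP: "[p] \<cdot>\<^bsub>P\<^esub> \<one>\<^bsub>P\<^esub> = \<zero>\<^bsub>P\<^esub>"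
      using c.hom_nat_one[of p] char by simp
    have Xq2: "X [^]\<^bsub>P\<^esub> q = b [^]\<^bsub>P\<^esub> q \<oplus>\<^bsub>P\<^esub> c"
      using UP.prime_power_add[OF p charP b c(1), of n] c(2) by (simp add: bc q_def)
    then have fb: "f = b [^]\<^bsub>P\<^esub> q \<ominus>\<^bsub>P\<^esub> b"
      using b c UP.nat_pow_closed[OF b, of q] unfolding f_def bc[symmetric] Xq2 unfolding bc by algebra
    have "b [^]\<^bsub>P\<^esub> (2::nat) pdivides f"
      using le_alg_mult_imp_pdivides[OF a(1), of f 2] m2 f unfolding b_def P_def by simp
    then obtain g where g: "g \<in> carrier P" "f = b [^]\<^bsub>P\<^esub> (2::nat) \<otimes>\<^bsub>P\<^esub> g"
      unfolding pdivides_def factor_def P_def by auto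
    obtain k where k: "q = Suc (Suc k)" using q by (metis add_2_eq_Suc le_Suc_ex)
    \<comment> \<open>From \<open>f = b^q - b\<close> and \<open>f = b^2 g\<close> follows
      \<open>b = b^2 (b^k - g)\<close>, where \<open>q = k + 2\<close>. Cancelling \<open>b\<close>
      makes \<open>d\<close> an inverse of \<open>b = X - a\<close>, which evaluation at
      \<open>a\<close> refutes.\<close>
    define d where "d = b [^]\<^bsub>P\<^esub> k \<ominus>\<^bsub>P\<^esub> g"
    have d: "d \<in> carrier P" using b g by (simp add: d_def)
    have "b \<otimes>\<^bsub>P\<^esub> (b \<otimes>\<^bsub>P\<^esub> d \<ominus>\<^bsub>P\<^esub> \<one>\<^bsub>P\<^esub>) = f \<ominus>\<^bsub>P\<^esub> f"
    proof -
      have *: "b \<otimes>\<^bsub>P\<^esub> (b \<otimes>\<^bsub>P\<^esub> (u \<ominus>\<^bsub>P\<^esub> g) \<ominus>\<^bsub>P\<^esub> \<one>\<^bsub>P\<^esub>)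
          = (u \<otimes>\<^bsub>P\<^esub> b \<otimes>\<^bsub>P\<^esub> b \<ominus>\<^bsub>P\<^esub> b) \<ominus>\<^bsub>P\<^esub> (b \<otimes>\<^bsub>P\<^esub> b \<otimes>\<^bsub>P\<^esub> g)"
        if "u \<in> carrier P" for u
        using that b g(1) by algebra
      have "f = b [^]\<^bsub>P\<^esub> k \<otimes>\<^bsub>P\<^esub> b \<otimes>\<^bsub>P\<^esub> b \<ominus>\<^bsub>P\<^esub> b" using fb b by (simp add: k)
      moreover have "f = b \<otimes>\<^bsub>P\<^esub> b \<otimes>\<^bsub>P\<^esub> g" using g b by (simp add: numeral_2_eq_2)
      ultimately show ?thesis unfolding d_def using *[of "b [^]\<^bsub>P\<^esub> k"] b by simp
    qed
    then have "b \<otimes>\<^bsub>P\<^esub> (b \<otimes>\<^bsub>P\<^esub> d \<ominus>\<^bsub>P\<^esub> \<one>\<^bsub>P\<^esub>) = \<zero>\<^bsub>P\<^esub>" using f by (simp add: UP.r_neg a_minus_def)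
    moreover have bn: "b \<noteq> \<zero>\<^bsub>P\<^esub>" by (simp add: b_def P_def univ_poly_zero)
    ultimately have "b \<otimes>\<^bsub>P\<^esub> d \<ominus>\<^bsub>P\<^esub> \<one>\<^bsub>P\<^esub> = \<zero>\<^bsub>P\<^esub>"
      using UP.integral[OF _ b] b d bn by auto
    then have bd: "b \<otimes>\<^bsub>P\<^esub> d = \<one>\<^bsub>P\<^esub>" using b d by simp
    interpret h: ring_hom_ring P L "\<lambda>g. eval g a" by (rule ev[OF a(1)])
    have "eval b a = \<zero>" using a by (simp add: b_def r_neg)
    then have "eval (b \<otimes>\<^bsub>P\<^esub> d) a = \<zero>" using b d by simp
    then show False using bd h.hom_one by simp
  qed
  have "size (roots f) = q"
    using roots_over_carrier[of f] f deg unfolding splitted_def P_def by simp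
  moreover have "roots f = mset_set (set_mset (roots f))"
  proof (rule multiset_eqI)
    fix a
    show "count (roots f) a = count (mset_set (set_mset (roots f))) a"
    proof (cases "a \<in># roots f")
      case True
      have "count (roots f) a \<le> 1"
        using mult[of a] alg_mult_eq_count_roots[of f] f by (simp add: P_def)
      with True have "count (roots f) a = 1" using count_greater_zero_iff[of "roots f" a] by linarith
      then show ?thesis using True by (simp add: count_mset_set)
    qed (simp add: not_in_iff count_mset_set)
  qed
  moreover have "set_mset (roots f) = {x \<in> carrier L. x [^] q = x}"
    using roots_mem_iff_is_root[of f] f root unfolding P_def by blast
  ultimately show ?thesis unfolding q_def[symmetric] by (metis size_mset_set)
qed

lemma (in algebraically_closed) subfield_fixed_power:
  assumes p: "Factorial_Ring.prime (p::nat)" and char: "[p] \<cdot> \<one> = \<zero>"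
  shows "subfield {x \<in> carrier L. x [^] (p ^ n) = x} L"
proof (rule subfieldI')
  have q0: "p ^ n \<noteq> 0" using p by auto
  show "subring {x \<in> carrier L. x [^] (p ^ n) = x} L"
  proof (rule subringI)
    show "\<ominus> x \<in> {x \<in> carrier L. x [^] (p ^ n) = x}" if "x \<in> {x \<in> carrier L. x [^] (p ^ n) = x}" for x
    proof -
      from that have x: "x \<in> carrier L" "x [^] (p ^ n) = x" by auto
      \<comment> \<open>Expanding a power of zero avoids the sign \<open>(-1)^(p ^ n)\<close>, which
        would need a case distinction on the parity of \<open>p\<close>.\<close>
      have "\<zero> = (x \<oplus> \<ominus> x) [^] (p ^ n)" using x q0 by (simp add: r_neg nat_pow_zero)
      also have "\<dots> = x \<oplus> (\<ominus> x) [^] (p ^ n)" using prime_power_add[OF p char, of x "\<ominus> x" n] x by simp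
      finally have "x \<oplus> (\<ominus> x) [^] (p ^ n) = \<zero>" by simp
      then have "(\<ominus> x) [^] (p ^ n) = \<ominus> x"
        using x minus_equality[of "(\<ominus> x) [^] (p ^ n)" x] by (simp add: a_comm)
      then show ?thesis using x by simp
    qed
  qed (auto simp: nat_pow_distrib prime_power_add[OF p char])
next
  fix k assume "k \<in> {x \<in> carrier L. x [^] (p ^ n) = x} - {\<zero>}"
  then have k: "k \<in> carrier L" "k [^] (p ^ n) = k" "k \<in> Units L" by (auto simp: field_Units)
  have "k \<otimes> (inv k) [^] (p ^ n) = k [^] (p ^ n) \<otimes> (inv k) [^] (p ^ n)"
    using k(2) by simp
  also have "\<dots> = (k \<otimes> inv k) [^] (p ^ n)"
    using k by (intro nat_pow_distrib [symmetric]) auto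
  finally have "k \<otimes> (inv k) [^] (p ^ n) = \<one>" using k by simp
  then have "inv k = (inv k) [^] (p ^ n)" using k by (intro comm_inv_char) auto
  then show "inv k \<in> {x \<in> carrier L. x [^] (p ^ n) = x}" using k by simp
qed

text \<open>The field consists of the fixed points of the \<open>q\<close>-th power map in the
  algebraic closure of the integers modulo \<open>p\<close>. Since a type cannot be quantified
  existentially, the statement names the type in which that closure is built.\<close>

theorem finite_field_exists:
  assumes "primepow (q::nat)"
  shows "\<exists>F :: (((int list \<times> nat) multiset) \<Rightarrow> int) ring. field F \<and> finite (carrier F) \<and> card (carrier F) = q"
proof -
  obtain p n where p: "Factorial_Ring.prime p" and n: "n > 0" and q: "q = p ^ n"
    using assms by (auto simp: primepow_def)
  interpret R: residues_prime p "residue_ring (int p)"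
    by (simp add: residues_prime_def p)
  obtain L :: "(((int list \<times> nat) multiset) \<Rightarrow> int) ring" where "algebraic_closure L (R.indexed_const ` carrier (residue_ring (int p)))"
      and hom: "R.indexed_const \<in> ring_hom (residue_ring (int p)) L"
    by (rule R.exists_closure)
  from this(1) interpret L: algebraic_closure L "R.indexed_const ` carrier (residue_ring (int p))" .
  interpret h: ring_hom_ring "residue_ring (int p)" L R.indexed_const
    by (rule ring_hom_ringI2[OF R.ring_axioms L.ring_axioms hom])
  have "[m] \<cdot>\<^bsub>residue_ring (int p)\<^esub> \<one>\<^bsub>residue_ring (int p)\<^esub> = int m mod int p" for m :: nat
  proof (induction m)
    case (Suc m)
    then show ?case by (simp add: add_pow_def R.res_add_eq R.res_one_eq mod_simps add.commute)
  qed (simp add: add_pow_def R.res_zero_eq)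
  then have "[p] \<cdot>\<^bsub>residue_ring (int p)\<^esub> \<one>\<^bsub>residue_ring (int p)\<^esub> = \<zero>\<^bsub>residue_ring (int p)\<^esub>"
    by (simp add: R.res_zero_eq)
  then have char: "[p] \<cdot>\<^bsub>L\<^esub> \<one>\<^bsub>L\<^esub> = \<zero>\<^bsub>L\<^esub>"
    using h.hom_nat_one[of p] by simp
  define F where "F = L\<lparr>carrier := {x \<in> carrier L. x [^]\<^bsub>L\<^esub> (p ^ n) = x}\<rparr>"
  have "field F" unfolding F_def
    by (rule L.subfield_iff(2)[OF L.subfield_fixed_power[OF p char]])
  moreover have "card (carrier F) = q"
    using L.card_fixed_power[OF p char n] by (simp add: F_def q)
  moreover have "q > 0" using p q by (simp add: prime_gt_0_nat)
  ultimately have "field F \<and> finite (carrier F) \<and> card (carrier F) = q"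
    using card_ge_0_finite[of "carrier F"] by simp
  then show ?thesis by (rule exI)
qed

section \<open>Designs from labelled arrays\<close>

lemma BIBD_matrixI:
  assumes "\<And>j. j < b \<Longrightarrow> card {i. i < v \<and> Q i j} = k"
    and "\<And>i. i < v \<Longrightarrow> card {j. j < b \<and> Q i j} = r"
    and "\<And>i i'. i < v \<Longrightarrow> i' < v \<Longrightarrow> i \<noteq> i' \<Longrightarrow> card {j. j < b \<and> Q i j \<and> Q i' j} = l"
  shows "BIBD_matrix (mat v b (\<lambda>(i, j). if Q i j then 1 else 0)) v b r k l"
proof -
  define Bs where "Bs = map (\<lambda>j. {i. i < v \<and> Q i j}) [0..<b]"
  have mem: "x \<in> Bs ! j \<longleftrightarrow> x < v \<and> Q x j" if "j < b" for x j
    using that by (simp add: Bs_def)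
  have "BIBD (set [0..<v]) Bs v b r k l"
    unfolding BIBD_def block_design_def using assms
    by (auto simp: mem Bs_def cong: conj_cong)
  moreover have "mat v b (\<lambda>(i, j). if Q i j then 1 else 0) = incidence_matrix [0..<v] Bs"
    unfolding incidence_matrix_def using mem by (intro eq_matI) (auto simp: Bs_def)
  ultimately show ?thesis unfolding BIBD_matrix_def using distinct_upt by blast
qed

text \<open>The first two moments of the block size are known, and its variance comes out as zero.\<close>
lemma block_size_constant:
  fixes k q v b :: nat
  assumes v: "v = k * q" and b: "b = (v - 1) * q" and v1: "v \<ge> 1"
    and row: "\<And>i. i < v \<Longrightarrow> card {j. j < b \<and> Q i j} = v - 1"
    and pair: "\<And>i i'. i < v \<Longrightarrow> i' < v \<Longrightarrow> i \<noteq> i' \<Longrightarrow> card {j. j < b \<and> Q i j \<and> Q i' j} = k - 1"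
    and j: "j < b"
  shows "card {i. i < v \<and> Q i j} = k"
proof -
  have k: "k \<ge> 1" using v v1 by (cases k) auto
  define w where "w i j = (of_bool (Q i j) :: int)" for i j
  define s where "s j = (\<Sum>i<v. w i j)" for j
  have card: "int (card {i. i < n \<and> R i}) = (\<Sum>i<n. of_bool (R i))" for n :: nat and R
    using sum.inter_filter[OF finite_lessThan, of "\<lambda>_. 1::int" n R] by (simp add: of_bool_def)
  have s1: "(\<Sum>j<b. s j) = int v * (int v - 1)"
  proof -
    have "(\<Sum>j<b. s j) = (\<Sum>i<v. \<Sum>j<b. w i j)" unfolding s_def by (rule sum.swap)
    also have "\<dots> = (\<Sum>i<v. int (v - 1))"
      using row card[of b] by (intro sum.cong) (auto simp: w_def)
    finally show ?thesis using v1 by (simp add: of_nat_diff)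
  qed
  have s2: "(\<Sum>j<b. s j * s j) = int v * (int v - 1) * int k"
  proof -
    have "(\<Sum>j<b. s j * s j) = (\<Sum>j<b. \<Sum>i<v. \<Sum>i'<v. w i j * w i' j)"
      unfolding s_def by (simp add: sum_product)
    also have "\<dots> = (\<Sum>i<v. \<Sum>j<b. \<Sum>i'<v. w i j * w i' j)" by (rule sum.swap)
    also have "\<dots> = (\<Sum>i<v. \<Sum>i'<v. \<Sum>j<b. w i j * w i' j)"
      by (intro sum.cong sum.swap refl)
    also have "\<dots> = (\<Sum>i<v. \<Sum>i'<v. if i' = i then int v - 1 else int k - 1)"
    proof (intro sum.cong refl)
      fix i i' assume i: "i \<in> {..<v}" "i' \<in> {..<v}"
      have "(\<Sum>j<b. w i j * w i' j) = int (card {j. j < b \<and> Q i j \<and> Q i' j})"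
        unfolding card w_def by (intro sum.cong) auto
      then show "(\<Sum>j<b. w i j * w i' j) = (if i' = i then int v - 1 else int k - 1)"
        using i row[of i] pair[of i i'] k v1 by (simp add: of_nat_diff)
    qed
    also have "\<dots> = (\<Sum>i<v. int v - 1 + (int v - 1) * (int k - 1))"
    proof (intro sum.cong refl)
      fix i assume i: "i \<in> {..<v}"
      then show "(\<Sum>i'<v. if i' = i then int v - 1 else int k - 1)
          = int v - 1 + (int v - 1) * (int k - 1)"
        using v1 by (subst sum.remove[of _ i]) (auto simp: of_nat_diff)
    qed
    finally show ?thesis by (simp add: algebra_simps)
  qed
  \<comment> \<open>The mean block size is \<open>v (v - 1) / b = k\<close>. Expanding around it
    gives \<open>- k v (v - 1) + (v - 1) q k^2\<close>, which vanishes because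
    \<open>k q = v\<close>; a sum of squares that is zero has only zero terms.\<close>
  have "(\<Sum>j<b. (s j - int k)\<^sup>2) = (\<Sum>j<b. s j * s j - 2 * int k * s j + int k * int k)"
    by (intro sum.cong) (auto simp: power2_eq_square algebra_simps)
  also have "\<dots> = int v * (int v - 1) * int k - 2 * int k * (int v * (int v - 1)) + int b * (int k * int k)"
    by (simp only: sum.distrib sum_subtractf s2 sum_distrib_left[symmetric] s1) simp
  also have "int b = (int v - 1) * int q" using v1 by (simp add: b of_nat_diff)
  also have "int v * (int v - 1) * int k - 2 * int k * (int v * (int v - 1)) + (int v - 1) * int q * (int k * int k) = 0"
    using v by (simp add: algebra_simps)
  finally have "(s j - int k)\<^sup>2 = 0"
    using j by (subst (asm) sum_nonneg_eq_0_iff) auto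
  then have "s j = int k" by simp
  moreover have "s j = int (card {i. i < v \<and> Q i j})" unfolding card s_def w_def ..
  ultimately show ?thesis by simp
qed

text \<open>Since all ordered pairs of labels are counted, the pairwise sums need no further input:
  two rows meet in \<open>N h + N h'\<close> in \<open>(k - 1) + (k - 1) + k + k\<close> columns,
  one summand for each way of labelling the two rows by \<open>h\<close> or
  \<open>h'\<close>.\<close>

lemma full_PAB_of_array:
  fixes L :: "nat \<Rightarrow> nat \<Rightarrow> nat"
  assumes v: "v = k * q" and b: "b = (v - 1) * q" and k: "k \<ge> 1" and q: "q \<ge> 2"
    and row: "\<And>i h. i < v \<Longrightarrow> h < q \<Longrightarrow> card {j. j < b \<and> L i j = h} = v - 1"
    and pair: "\<And>i i' h h'. i < v \<Longrightarrow> i' < v \<Longrightarrow> i \<noteq> i' \<Longrightarrow> h < q \<Longrightarrow> h' < q \<Longrightarrow>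
      card {j. j < b \<and> L i j = h \<and> L i' j = h'} = (if h = h' then k - 1 else k)"
  shows "\<exists>Ns. full_PAB v k (k - 1) Ns"
proof -
  have "k * q \<ge> 1 * 2" using k q by (intro mult_mono) auto
  then have v2: "v \<ge> 2" using v by simp
  define N where "N h = (mat v b (\<lambda>(i, j). if L i j = h then 1 else 0) :: nat mat)" for h
  define Ns where "Ns = map N [0..<q]"
  have Ns: "Ns ! h = N h" if "h < q" for h using that by (simp add: Ns_def)
  have pair1: "card {j. j < b \<and> L i j = h \<and> L i' j = h} = k - 1"
    if "i < v" "i' < v" "i \<noteq> i'" "h < q" for i i' h
    using pair[OF that(1-4,4)] by simp
  have size: "card {i. i < v \<and> L i j = h} = k" if "j < b" "h < q" for j h
    using v2 that by (intro block_size_constant[OF v b]) (auto simp: row pair1)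
  have single: "BIBD_matrix (N h) v b (v - 1) k (k - 1)" if h: "h < q" for h
    unfolding N_def using size row pair1 h by (intro BIBD_matrixI) auto
  have double: "BIBD_matrix (N h + N h') v b (2 * (v - 1)) (2 * k) (4 * k - 2)"
    if h: "h < q" "h' < q" "h \<noteq> h'" for h h'
  proof -
    have "N h + N h' = mat v b (\<lambda>(i, j). if L i j = h \<or> L i j = h' then 1 else 0)"
      using h(3) unfolding N_def by (intro eq_matI) auto
    moreover have "BIBD_matrix (mat v b (\<lambda>(i, j). if L i j = h \<or> L i j = h' then 1 else 0)) v b
        (2 * (v - 1)) (2 * k) (4 * k - 2)"
    proof (rule BIBD_matrixI)
      have un: "card (A \<union> B) = m + n" if "card A = m" "card B = n" "finite A" "finite B" "A \<inter> B = {}"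
        for A B :: "nat set" and m n using that card_Un_disjoint by blast
      show "card {i. i < v \<and> (L i j = h \<or> L i j = h')} = 2 * k" if "j < b" for j
      proof -
        have "{i. i < v \<and> (L i j = h \<or> L i j = h')} = {i. i < v \<and> L i j = h} \<union> {i. i < v \<and> L i j = h'}" by auto
        moreover have "{i. i < v \<and> L i j = h} \<inter> {i. i < v \<and> L i j = h'} = {}" using h(3) by auto
        ultimately show ?thesis using un[OF size[OF that h(1)] size[OF that h(2)]] by simp
      qed
      show "card {j. j < b \<and> (L i j = h \<or> L i j = h')} = 2 * (v - 1)" if "i < v" for i
      proof -
        have "{j. j < b \<and> (L i j = h \<or> L i j = h')} = {j. j < b \<and> L i j = h} \<union> {j. j < b \<and> L i j = h'}" by auto
        moreover have "{j. j < b \<and> L i j = h} \<inter> {j. j < b \<and> L i j = h'} = {}" using h(3) by auto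
        ultimately show ?thesis using un[OF row[OF that h(1)] row[OF that h(2)]] by simp
      qed
      show "card {j. j < b \<and> (L i j = h \<or> L i j = h') \<and> (L i' j = h \<or> L i' j = h')} = 4 * k - 2"
        if i: "i < v" "i' < v" "i \<noteq> i'" for i i'
      proof -
        define A where "A x y = {j. j < b \<and> L i j = x \<and> L i' j = y}" for x y
        have A: "card (A x y) = (if x = y then k - 1 else k)" if "x \<in> {h, h'}" "y \<in> {h, h'}" for x y
          using pair[OF i, of x y] that h by (auto simp: A_def)
        have fin: "finite (A x y)" for x y by (simp add: A_def)
        have disj: "A x y \<inter> A x' y' = {}" if "(x, y) \<noteq> (x', y')" for x y x' y'
          using that by (auto simp: A_def)
        have "{j. j < b \<and> (L i j = h \<or> L i j = h') \<and> (L i' j = h \<or> L i' j = h')}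
            = (A h h \<union> A h' h') \<union> (A h h' \<union> A h' h)" by (auto simp: A_def)
        also have "card \<dots> = ((k - 1) + (k - 1)) + (k + k)"
          by (intro un) (use h(3) in \<open>simp_all add: A fin disj Int_Un_distrib Int_Un_distrib2\<close>)
        finally show ?thesis using k by simp
      qed
    qed
    ultimately show ?thesis by simp
  qed
  \<comment> \<open>With \<open>r = v - 1\<close> the prescribed index
    \<open>2 r (2 k - 1) / (v - 1)\<close> reduces to \<open>2 (2 k - 1)\<close>. The subtraction is
    not truncated, as \<open>k\<close> is positive.\<close>
  have "real (4 * k - 2) = 2 * real (v - 1) * (2 * real k - 1) / (real v - 1)"
    using v2 k by (simp add: of_nat_diff field_simps)
  moreover have "N h $$ (i, j) * N h' $$ (i, j) = 0" if "i < v" "j < b" "h \<noteq> h'" for i j h h'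
    using that by (simp add: N_def)
  ultimately have "PAB q v k (k - 1) Ns"
    unfolding PAB_def using single double
    by (intro conjI exI[of _ b] exI[of _ "v - 1"]) (auto simp: Ns Ns_def[THEN arg_cong, of length] intro!: exI[of _ "4 * k - 2"])
  moreover have "real q = real v / real k" using k by (simp add: v)
  ultimately show ?thesis unfolding full_PAB_def by blast
qed

section \<open>Generalized Hadamard matrices\<close>

text \<open>The last condition is a division-free form of the requirement that the quotients of two
  rows be uniformly distributed over the group. Arbitrary index types allow field elements, pairs
  and numbers as rows.\<close>

definition generalized_hadamard ::
  "('g, 'z) monoid_scheme \<Rightarrow> 'i set \<Rightarrow> 'j set \<Rightarrow> ('i \<Rightarrow> 'j \<Rightarrow> 'g) \<Rightarrow> nat \<Rightarrow> bool" where
  "generalized_hadamard G I J M k \<longleftrightarrow>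
     finite I \<and> finite J \<and> finite (carrier G) \<and>
     card I = k * card (carrier G) \<and> card J = k * card (carrier G) \<and>
     (\<forall>i\<in>I. \<forall>j\<in>J. M i j \<in> carrier G) \<and>
     (\<forall>i\<in>I. \<forall>i'\<in>I. i \<noteq> i' \<longrightarrow>
        (\<forall>g\<in>carrier G. card {j \<in> J. M i j = g \<otimes>\<^bsub>G\<^esub> M i' j} = k))"

lemma card_bij_betw_Collect:
  assumes "bij_betw e A B"
  shows "card {a \<in> A. Q (e a)} = card {x \<in> B. Q x}"
proof -
  have "bij_betw e {a \<in> A. Q (e a)} {x \<in> B. Q x}"
    using assms by (auto simp: bij_betw_def inj_on_def)
  then show ?thesis by (rule bij_betw_same_card)
qed

lemma card_Collect_Times:
  assumes "finite A" "finite T"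
  shows "card {j \<in> A \<times> T. Q j} = (\<Sum>t\<in>T. card {y \<in> A. Q (y, t)})"
proof -
  have "{j \<in> A \<times> T. Q j} = prod.swap ` (SIGMA t:T. {y \<in> A. Q (y, t)})" by force
  then have "card {j \<in> A \<times> T. Q j} = card (SIGMA t:T. {y \<in> A. Q (y, t)})"
    by (simp add: card_image)
  then show ?thesis using assms by simp
qed

text \<open>For the translates \<open>(j, g)\<close> of a column: one prescribed label in one row
  determines \<open>g\<close> from \<open>j\<close>, so counting translates reduces to counting
  columns.\<close>

lemma card_graph_Collect:
  assumes "\<And>j. j \<in> J \<Longrightarrow> f j \<in> G"
  shows "card {(j, g). j \<in> J \<and> g \<in> G \<and> g = f j \<and> Q j} = card {j \<in> J. Q j}"
proof -
  have "{(j, g). j \<in> J \<and> g \<in> G \<and> g = f j \<and> Q j} = (\<lambda>j. (j, f j)) ` {j \<in> J. Q j}"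
    using assms by auto
  then show ?thesis by (simp add: card_image inj_on_def)
qed

lemma (in comm_group) generalized_hadamard_imp_full_PAB:
  assumes GH: "generalized_hadamard G I J M k" and k: "k \<ge> 1" and q: "card (carrier G) = q" "q \<ge> 2"
  shows "\<exists>Ns. full_PAB (k * q) k (k - 1) Ns"
proof -
  define v where "v = k * q"
  define b where "b = (v - 1) * q"
  have fin: "finite I" "finite J" "finite (carrier G)" and card: "card I = v" "card J = v"
    and M: "\<And>i j. i \<in> I \<Longrightarrow> j \<in> J \<Longrightarrow> M i j \<in> carrier G"
    and eq: "\<And>i i' g. i \<in> I \<Longrightarrow> i' \<in> I \<Longrightarrow> i \<noteq> i' \<Longrightarrow> g \<in> carrier G \<Longrightarrow>
      card {j \<in> J. M i j = g \<otimes> M i' j} = k"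
    using GH q by (auto simp: generalized_hadamard_def v_def)
  have "k * q \<ge> 1 * 2" using k q by (intro mult_mono) auto
  then have "J \<noteq> {}" using card by (auto simp: v_def)
  then obtain j0 where j0: "j0 \<in> J" by blast
  define C where "C = (J - {j0}) \<times> carrier G"
  \<comment> \<open>Normalising by column \<open>j0\<close> makes its entries the identity in every
    row. Each translate of it would carry a single label throughout, hence its removal from
    \<open>C\<close>.\<close>
  define N where "N i j = M i j \<otimes> inv (M i j0)" for i j
  have N: "N i j \<in> carrier G" if "i \<in> I" "j \<in> J" for i j using M that j0 by (simp add: N_def)
  have C: "finite C" "card C = b"
    using fin card j0 q by (simp_all add: C_def b_def card_cartesian_product)
  obtain eI where eI: "bij_betw eI {..<v} I"
    using ex_bij_betw_nat_finite[OF fin(1)] card by (auto simp: lessThan_atLeast0)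
  obtain eC where eC: "bij_betw eC {..<b} C"
    using ex_bij_betw_nat_finite[OF C(1)] C(2) by (auto simp: lessThan_atLeast0)
  obtain eG where eG: "bij_betw eG {..<q} (carrier G)"
    using ex_bij_betw_nat_finite[OF fin(3)] q(1) by (auto simp: lessThan_atLeast0)
  define label where "label i c = N i (fst c) \<otimes> snd c" for i c
  define L where "L i j = inv_into {..<q} eG (label (eI i) (eC j))" for i j
  have eI': "eI i \<in> I" if "i < v" for i using that eI by (auto simp: bij_betw_def)
  have eC': "eC j \<in> C" if "j < b" for j using that eC by (auto simp: bij_betw_def)
  have eG': "eG h \<in> carrier G" if "h < q" for h using that eG by (auto simp: bij_betw_def)
  have eG_inj: "eG h = eG h' \<longleftrightarrow> h = h'" if "h < q" "h' < q" for h h'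
    using that eG by (auto simp: bij_betw_def inj_on_def)
  have L: "L i j = h \<longleftrightarrow> label (eI i) (eC j) = eG h" if "i < v" "j < b" "h < q" for i j h
  proof -
    have "label (eI i) (eC j) \<in> carrier G"
      using N eI'[OF that(1)] eC'[OF that(2)] by (auto simp: label_def C_def)
    then show ?thesis
      unfolding L_def using eG that(3)
      by (metis bij_betw_inv_into_left bij_betw_inv_into_right lessThan_iff)
  qed
  have row: "card {c \<in> C. label i c = h} = v - 1" if i: "i \<in> I" and h: "h \<in> carrier G" for i h
  proof -
    have lab: "label i (j, g) = h \<longleftrightarrow> g = inv (N i j) \<otimes> h" if "j \<in> J" "g \<in> carrier G" for j g
      using that N[OF i, of j] h unfolding label_def by (auto simp: inv_solve_left)
    have "{c \<in> C. label i c = h}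
        = {(j, g). j \<in> J - {j0} \<and> g \<in> carrier G \<and> g = inv (N i j) \<otimes> h \<and> True}"
      (is "?A = ?B")
    proof (rule Set.set_eqI)
      show "c \<in> ?A \<longleftrightarrow> c \<in> ?B" for c
        by (cases c) (simp add: C_def lab cong: conj_cong)
    qed
    also have "card \<dots> = card {j \<in> J - {j0}. True}"
      using N[OF i] h by (intro card_graph_Collect) auto
    also have "{j \<in> J - {j0}. True} = J - {j0}" by auto
    finally show ?thesis using j0 card fin by simp
  qed
  have pair: "card {c \<in> C. label i c = h \<and> label i' c = h'} = (if h = h' then k - 1 else k)"
    if i: "i \<in> I" "i' \<in> I" "i \<noteq> i'" and h: "h \<in> carrier G" "h' \<in> carrier G" for i i' h h'
  proof -
    \<comment> \<open>The quotient that the original entries must have for the normalised quotient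
      to be \<open>h\<close> divided by \<open>h'\<close>; only for such \<open>j\<close> does some
      translate show \<open>h\<close> and \<open>h'\<close> together.\<close>
    define t where "t = h \<otimes> inv h' \<otimes> (M i j0 \<otimes> inv (M i' j0))"
    have t: "t \<in> carrier G" using i h M j0 by (simp add: t_def)
    have *: "N i j \<otimes> (inv (N i' j) \<otimes> h') = h \<longleftrightarrow> M i j = t \<otimes> M i' j" if j: "j \<in> J" for j
    proof -
      define m m' n n' where "m = M i j" and "m' = M i' j" and "n = M i j0" and "n' = M i' j0"
      have c: "m \<in> carrier G" "m' \<in> carrier G" "n \<in> carrier G" "n' \<in> carrier G"
        using M i j j0 by (auto simp: m_def m'_def n_def n'_def)
      define u where "u = inv h' \<otimes> n \<otimes> inv n' \<otimes> m'"
      have u: "u \<in> carrier G" using c h by (simp add: u_def)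
      have "N i j \<otimes> (inv (N i' j) \<otimes> h') = m \<otimes> inv u"
        using c h unfolding N_def u_def m_def[symmetric] m'_def[symmetric] n_def[symmetric] n'_def[symmetric]
        by (simp add: inv_mult m_ac)
      moreover have "t \<otimes> m' = h \<otimes> u"
        using c h unfolding t_def u_def n_def[symmetric] n'_def[symmetric] by (simp add: m_ac)
      moreover have "m \<otimes> inv u = h \<longleftrightarrow> m = h \<otimes> u"
        using c u h inv_solve_right[of h m u] by (metis)
      ultimately show ?thesis by (simp add: m_def m'_def)
    qed
    have lab: "label i' (j, g) = h' \<longleftrightarrow> g = inv (N i' j) \<otimes> h'" if "j \<in> J" "g \<in> carrier G" for j g
      using that N[OF i(2), of j] h unfolding label_def by (auto simp: inv_solve_left)
    have "{c \<in> C. label i c = h \<and> label i' c = h'}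
        = {(j, g). j \<in> J - {j0} \<and> g \<in> carrier G \<and> g = inv (N i' j) \<otimes> h' \<and> M i j = t \<otimes> M i' j}"
      (is "?A = ?B")
    proof (rule Set.set_eqI)
      have both: "label i (j, g) = h \<and> label i' (j, g) = h' \<longleftrightarrow>
          g = inv (N i' j) \<otimes> h' \<and> M i j = t \<otimes> M i' j" if "j \<in> J" "g \<in> carrier G" for j g
      proof -
        have "label i (j, g) = N i j \<otimes> g" by (simp add: label_def)
        then show ?thesis using lab[OF that] *[OF that(1)] by metis
      qed
      show "c \<in> ?A \<longleftrightarrow> c \<in> ?B" for c
        by (cases c) (simp add: C_def both cong: conj_cong)
    qed
    also have "card \<dots> = card {j \<in> J - {j0}. M i j = t \<otimes> M i' j}"
      using N[OF i(2)] h by (intro card_graph_Collect) auto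
    also have "{j \<in> J - {j0}. M i j = t \<otimes> M i' j} = {j \<in> J. M i j = t \<otimes> M i' j} - {j0}" by auto
    also have "card \<dots> = (if M i j0 = t \<otimes> M i' j0 then k - 1 else k)"
      using eq[OF i t] j0 fin(2) by (auto simp: card_Diff_singleton_if)
    \<comment> \<open>The deleted column has the quotient \<open>t\<close> exactly when
      \<open>h = h'\<close>: this is the origin of the difference between \<open>k - 1\<close> and
      \<open>k\<close>.\<close>
    also have "M i j0 = t \<otimes> M i' j0 \<longleftrightarrow> h = h'"
    proof -
      have "N i j0 = \<one>" "N i' j0 = \<one>" using M i j0 by (auto simp: N_def)
      then show ?thesis using *[OF j0] h by auto
    qed
    finally show ?thesis .
  qed
  have "\<exists>Ns. full_PAB v k (k - 1) Ns"
  proof (rule full_PAB_of_array[OF v_def b_def k q(2)])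
    show "card {j. j < b \<and> L i j = h} = v - 1" if "i < v" "h < q" for i h
    proof -
      have "{j. j < b \<and> L i j = h} = {j \<in> {..<b}. label (eI i) (eC j) = eG h}" using L that by auto
      then show ?thesis
        using card_bij_betw_Collect[OF eC, of "\<lambda>c. label (eI i) c = eG h"] row[OF eI' eG', OF that] by simp
    qed
    show "card {j. j < b \<and> L i j = h \<and> L i' j = h'} = (if h = h' then k - 1 else k)"
      if i: "i < v" "i' < v" "i \<noteq> i'" and h: "h < q" "h' < q" for i i' h h'
    proof -
      have ne: "eI i \<noteq> eI i'" using eI i by (auto simp: bij_betw_def inj_on_def)
      have "{j. j < b \<and> L i j = h \<and> L i' j = h'}
          = {j \<in> {..<b}. label (eI i) (eC j) = eG h \<and> label (eI i') (eC j) = eG h'}"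
        using L i h by auto
      then show ?thesis
        using card_bij_betw_Collect[OF eC, of "\<lambda>c. label (eI i) c = eG h \<and> label (eI i') c = eG h'"]
          pair[OF eI'[OF i(1)] eI'[OF i(2)] ne eG'[OF h(1)] eG'[OF h(2)]] eG_inj[OF h] by simp
    qed
  qed
  then show ?thesis by (simp add: v_def)
qed

section \<open>Quotients of generalized Hadamard matrices and the case of one common prime\<close>

lemma (in comm_group) generalized_hadamard_Mod:
  assumes GH: "generalized_hadamard G I J M k" and K: "subgroup K G"
  shows "generalized_hadamard (G Mod K) I J (\<lambda>i j. K #> M i j) (k * card K)"
proof -
  have N: "K \<lhd> G" using K by (rule subgroup_imp_normal)
  have M: "\<And>i j. i \<in> I \<Longrightarrow> j \<in> J \<Longrightarrow> M i j \<in> carrier G"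
    and fin: "finite I" "finite J" "finite (carrier G)"
    and eq: "\<And>i i' g. i \<in> I \<Longrightarrow> i' \<in> I \<Longrightarrow> i \<noteq> i' \<Longrightarrow> g \<in> carrier G \<Longrightarrow>
      card {j \<in> J. M i j = g \<otimes> M i' j} = k"
    using GH by (auto simp: generalized_hadamard_def)
  have KG: "K \<subseteq> carrier G" using K by (rule subgroup.subset)
  have lag: "card (rcosets K) * card K = card (carrier G)"
    using lagrange[OF K] by (simp add: order_def)
  have "card {j \<in> J. K #> M i j = g <#> (K #> M i' j)} = k * card K"
    if i: "i \<in> I" "i' \<in> I" "i \<noteq> i'" and g: "g \<in> rcosets K" for i i' g
  proof -
    obtain a where a: "a \<in> carrier G" "g = K #> a" using g by (auto simp: RCOSETS_def)
    have gG: "g \<subseteq> carrier G" using a KG by (simp add: r_coset_subset_G)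
    \<comment> \<open>The cosets of two entries have quotient \<open>g\<close> when some
      \<open>u\<close> in \<open>g\<close> is the quotient of the entries themselves. Different
      \<open>u\<close> give disjoint sets of columns, and each of the \<open>card K\<close> elements
      of \<open>g\<close> contributes \<open>k\<close>.\<close>
    have "{j \<in> J. K #> M i j = g <#> (K #> M i' j)} = (\<Union>u\<in>g. {j \<in> J. M i j = u \<otimes> M i' j})"
    proof -
      have "K #> M i j = g <#> (K #> M i' j) \<longleftrightarrow> (\<exists>u\<in>g. M i j = u \<otimes> M i' j)" if j: "j \<in> J" for j
      proof -
        have m: "M i j \<in> carrier G" "M i' j \<in> carrier G" using M i j by auto
        have "g <#> (K #> M i' j) = K #> (a \<otimes> M i' j)"
          using a m by (simp add: normal.rcos_sum[OF N])
        moreover have "K #> M i j = K #> (a \<otimes> M i' j) \<longleftrightarrow> M i j \<in> K #> (a \<otimes> M i' j)"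
          using a m K KG by (metis m_closed rcos_self repr_independence)
        moreover have "M i j \<in> K #> (a \<otimes> M i' j) \<longleftrightarrow> (\<exists>u\<in>g. M i j = u \<otimes> M i' j)"
          using a m KG by (auto simp: r_coset_def m_assoc subset_iff)
        ultimately show ?thesis by simp
      qed
      then show ?thesis by auto
    qed
    also have "card \<dots> = (\<Sum>u\<in>g. card {j \<in> J. M i j = u \<otimes> M i' j})"
    proof (rule card_UN_disjoint)
      show "finite g" using gG fin finite_subset by blast
      show "\<forall>u\<in>g. finite {j \<in> J. M i j = u \<otimes> M i' j}" using fin by simp
      show "\<forall>u\<in>g. \<forall>u'\<in>g. u \<noteq> u' \<longrightarrow>
          {j \<in> J. M i j = u \<otimes> M i' j} \<inter> {j \<in> J. M i j = u' \<otimes> M i' j} = {}"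
        using M[OF i(2)] gG r_cancel[of _ "M i' _"] by (fastforce dest: subsetD)
    qed
    also have "\<dots> = (\<Sum>u\<in>g. k)" using eq[OF i] gG by (intro sum.cong) auto
    also have "\<dots> = k * card g" by simp
    also have "card g = card K" using card_rcosets_equal[OF g KG] by simp
    finally show ?thesis by simp
  qed
  moreover have "K #> M i j \<in> rcosets K" if "i \<in> I" "j \<in> J" for i j
    using M[OF that] KG by (simp add: rcosetsI)
  moreover have "finite (rcosets K)" using fin(3) by (simp add: RCOSETS_def)
  ultimately show ?thesis
    using GH lag unfolding generalized_hadamard_def by (simp add: FactGroup_def mult.assoc mult.commute)
qed

text \<open>The difference of two rows is \<open>(x - x') y\<close>, a bijection in \<open>y\<close>
  for \<open>x\<close> distinct from \<open>x'\<close>, so every value occurs once.\<close>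

lemma (in field) generalized_hadamard_mult_table:
  assumes fin: "finite (carrier R)"
  shows "generalized_hadamard (add_monoid R) (carrier R) (carrier R) (\<otimes>) 1"
proof -
  have "card {y \<in> carrier R. x \<otimes> y = g \<oplus> x' \<otimes> y} = 1"
    if x: "x \<in> carrier R" "x' \<in> carrier R" "x \<noteq> x'" and g: "g \<in> carrier R" for x x' g
  proof -
    define d where "d = x \<ominus> x'"
    have d: "d \<in> carrier R" "d \<in> Units R" using x by (auto simp: d_def field_Units)
    have "x \<otimes> y = g \<oplus> x' \<otimes> y \<longleftrightarrow> y = inv d \<otimes> g" if y: "y \<in> carrier R" for y
    proof -
      have "x \<otimes> y = g \<oplus> x' \<otimes> y \<longleftrightarrow> d \<otimes> y = g"
      proof
        assume *: "x \<otimes> y = g \<oplus> x' \<otimes> y"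
        have "d \<otimes> y = x \<otimes> y \<ominus> x' \<otimes> y" unfolding d_def using x y by algebra
        also have "\<dots> = g" unfolding * using x y g by algebra
        finally show "d \<otimes> y = g" .
      next
        have "x \<otimes> y = d \<otimes> y \<oplus> x' \<otimes> y" unfolding d_def using x y by algebra
        moreover assume "d \<otimes> y = g"
        ultimately show "x \<otimes> y = g \<oplus> x' \<otimes> y" by simp
      qed
      also have "\<dots> \<longleftrightarrow> y = inv d \<otimes> g"
        using y d g by (metis Units_inv_closed Units_l_inv Units_r_inv l_one m_assoc)
      finally show ?thesis .
    qed
    then have "{y \<in> carrier R. x \<otimes> y = g \<oplus> x' \<otimes> y} = {inv d \<otimes> g}" using d g by auto
    then show ?thesis by simp
  qed
  then show ?thesis using fin by (auto simp: generalized_hadamard_def)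
qed

text \<open>A field of order \<open>k * q\<close> exists because \<open>k\<close> and
  \<open>q\<close> are powers of the same prime. The Sylow theorem is used in the form that yields a
  subgroup for any power of \<open>p\<close> dividing the group order, not only for the
  largest.\<close>

lemma full_PAB_prime_power_multiple:
  assumes p: "Factorial_Ring.prime p" and k: "k = p ^ a" and q: "q = p ^ n" "n > 0"
  shows "\<exists>Ns. full_PAB (k * q) k (k - 1) Ns"
proof -
  have "primepow (k * q)" using p q unfolding k q(1) power_add[symmetric] primepow_def by auto
  then obtain F :: "(((int list \<times> nat) multiset) \<Rightarrow> int) ring"
    where F: "field F" "finite (carrier F)" "card (carrier F) = k * q"
    using finite_field_exists by blast
  interpret field F by (rule F)
  obtain K where K: "subgroup K (add_monoid F)" "card K = k"
    using sylow_thm[of p "add_monoid F" a q] p F add.group_axioms k by (auto simp: order_def)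
  interpret Q: comm_group "add_monoid F Mod K"
    by (rule comm_group.abelian_FactGroup[OF a_comm_group K(1)])
  have "card (rcosets\<^bsub>add_monoid F\<^esub> K) * k = k * q"
    using add.lagrange[OF K(1)] K(2) F(3) by (simp add: order_def)
  moreover have "k \<ge> 1" using p k by (simp add: prime_gt_0_nat Suc_leI)
  ultimately have "card (carrier (add_monoid F Mod K)) = q" by (simp add: FactGroup_def)
  moreover have "q \<ge> 2" using p q prime_ge_2_nat by (metis self_le_power le_trans one_le_numeral)
  ultimately show ?thesis
    using Q.generalized_hadamard_imp_full_PAB[OF
        add.generalized_hadamard_Mod[OF generalized_hadamard_mult_table[OF F(2)] K(1)]] K(2) \<open>k \<ge> 1\<close>
    by simp
qed

section \<open>Squares in finite fields of odd order\<close>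

text \<open>A Boolean quadratic character: on nonzero elements its multiplicativity becomes a
  biconditional. Zero counts as a square and has to be kept apart.\<close>

definition (in ring) is_sq :: "'a \<Rightarrow> bool" where
  "is_sq z \<longleftrightarrow> (\<exists>y\<in>carrier R. z = y \<otimes> y)"

definition (in ring) num_sqrt :: "'a \<Rightarrow> nat" where
  "num_sqrt z = card {y \<in> carrier R. y \<otimes> y = z}"

locale finite_odd_field = field R for R (structure) +
  assumes finite_carrier: "finite (carrier R)" and two_nonzero: "\<one> \<oplus> \<one> \<noteq> \<zero>"
begin

lemma square_eq_iff: "y \<otimes> y = z \<otimes> z \<longleftrightarrow> y = z \<or> y = \<ominus> z"
  if "y \<in> carrier R" "z \<in> carrier R"
proof
  assume eq: "y \<otimes> y = z \<otimes> z"
  have "(y \<ominus> z) \<otimes> (y \<oplus> z) = y \<otimes> y \<ominus> z \<otimes> z" using that by algebra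
  also have "\<dots> = \<zero>" unfolding eq using that by algebra
  finally have "y \<ominus> z = \<zero> \<or> y \<oplus> z = \<zero>" using integral_iff that by simp
  then show "y = z \<or> y = \<ominus> z" using that minus_equality[of y z] by auto
next
  have "\<ominus> z \<otimes> \<ominus> z = z \<otimes> z" using that by algebra
  then show "y \<otimes> y = z \<otimes> z" if "y = z \<or> y = \<ominus> z" using that by auto
qed

lemma uminus_neq_self: "\<ominus> y \<noteq> y" if "y \<in> carrier R" "y \<noteq> \<zero>"
proof
  assume "\<ominus> y = y"
  then have "y \<oplus> y = \<zero>" using that r_neg by metis
  moreover have "y \<oplus> y = (\<one> \<oplus> \<one>) \<otimes> y" using that by algebra
  ultimately show False using integral_iff two_nonzero that by simp
qed

lemma num_sqrt_zero: "num_sqrt \<zero> = 1"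
proof -
  have "{y \<in> carrier R. y \<otimes> y = \<zero>} = {\<zero>}" using integral_iff by auto
  then show ?thesis by (simp add: num_sqrt_def)
qed

lemma num_sqrt_nonzero: "num_sqrt z = (if is_sq z then 2 else 0)" if "z \<in> carrier R" "z \<noteq> \<zero>"
proof (cases "is_sq z")
  case True
  then obtain x where x: "x \<in> carrier R" "z = x \<otimes> x" by (auto simp: is_sq_def)
  then have "x \<noteq> \<zero>" using that by auto
  have "{y \<in> carrier R. y \<otimes> y = z} = {x, \<ominus> x}" using x square_eq_iff by auto
  then show ?thesis using True uminus_neq_self[OF x(1) \<open>x \<noteq> \<zero>\<close>] by (simp add: num_sqrt_def)
next
  case False
  then have "{y \<in> carrier R. y \<otimes> y = z} = {}" by (auto simp: is_sq_def)
  then have "num_sqrt z = 0" unfolding num_sqrt_def by (simp only: card.empty)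
  then show ?thesis using False by simp
qed

text \<open>Squaring maps the nonzero elements two-to-one onto the nonzero squares.\<close>

lemma card_nonzero_squares: "2 * card {z \<in> carrier R - {\<zero>}. is_sq z} = card (carrier R - {\<zero>})"
proof -
  let ?Q = "{z \<in> carrier R - {\<zero>}. is_sq z}"
  have "carrier R - {\<zero>} = (\<Union>z\<in>?Q. {y \<in> carrier R. y \<otimes> y = z})"
    using integral_iff by (auto simp: is_sq_def)
  also have "card \<dots> = (\<Sum>z\<in>?Q. card {y \<in> carrier R. y \<otimes> y = z})"
    using finite_carrier by (intro card_UN_disjoint) auto
  also have "\<dots> = (\<Sum>z\<in>?Q. 2)"
    using num_sqrt_nonzero by (intro sum.cong) (auto simp: num_sqrt_def)
  finally show ?thesis by simp
qed

lemma is_sq_mult_iff: "is_sq (u \<otimes> v) \<longleftrightarrow> (is_sq u \<longleftrightarrow> is_sq v)"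
  if u: "u \<in> carrier R" "u \<noteq> \<zero>" and v: "v \<in> carrier R" "v \<noteq> \<zero>"
proof -
  have mult: "is_sq (a \<otimes> b)" if ab: "is_sq a" "is_sq b" for a b
  proof -
    obtain y z where yz: "y \<in> carrier R" "z \<in> carrier R" "a = y \<otimes> y" "b = z \<otimes> z"
      using ab by (auto simp: is_sq_def)
    have "a \<otimes> b = (y \<otimes> z) \<otimes> (y \<otimes> z)" unfolding yz(3,4) using yz(1,2) by algebra
    then show ?thesis using yz by (auto simp: is_sq_def)
  qed
  have quot: "is_sq b" if ab: "is_sq a" "is_sq (a \<otimes> b)" "a \<noteq> \<zero>" "b \<in> carrier R" for a b
  proof -
    obtain y where y: "y \<in> carrier R" "a = y \<otimes> y" using ab by (auto simp: is_sq_def)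
    then have "y \<noteq> \<zero>" using ab by auto
    then have yU: "y \<in> Units R" using y by (simp add: field_Units)
    have "b = (y \<otimes> inv y) \<otimes> (y \<otimes> inv y) \<otimes> b" using yU ab by simp
    also have "\<dots> = (inv y \<otimes> inv y) \<otimes> (a \<otimes> b)"
      unfolding y(2) using y(1) yU ab Units_inv_closed[OF yU] by algebra
    finally have "b = (inv y \<otimes> inv y) \<otimes> (a \<otimes> b)" .
    moreover have "is_sq (inv y \<otimes> inv y)" using yU by (auto simp: is_sq_def)
    ultimately show ?thesis using mult ab(2) by metis
  qed
  let ?Q = "{z \<in> carrier R - {\<zero>}. is_sq z}"
  \<comment> \<open>Multiplication by the nonsquare \<open>u\<close> maps the nonzero squares
    injectively into the nonsquares. The two sets are equally large, so \<open>v = u w\<close> for a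
    square \<open>w\<close>, and \<open>u v = u^2 w\<close>.\<close>
  have nn: "is_sq (u \<otimes> v)" if nu: "\<not> is_sq u" and nv: "\<not> is_sq v"
  proof -
    have inj: "inj_on (\<lambda>w. u \<otimes> w) ?Q" using u by (auto simp: inj_on_def m_lcancel)
    have "(\<lambda>w. u \<otimes> w) ` ?Q \<subseteq> carrier R - {\<zero>} - ?Q"
    proof (intro image_subsetI DiffI CollectI notI)
      fix w assume w: "w \<in> ?Q"
      show "u \<otimes> w \<in> carrier R" using u w by simp
      show False if "u \<otimes> w \<in> {\<zero>}" using that u w integral_iff by auto
      show False if "u \<otimes> w \<in> ?Q"
        using that nu quot[of w u] u w by (auto simp: m_comm)
    qed
    moreover have "card (carrier R - {\<zero>} - ?Q) = card ?Q"
      using card_nonzero_squares finite_carrier by (subst card_Diff_subset) auto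
    ultimately have "(\<lambda>w. u \<otimes> w) ` ?Q = carrier R - {\<zero>} - ?Q"
      using finite_carrier card_image[OF inj] by (intro card_subset_eq) auto
    then obtain w where w: "w \<in> carrier R" "is_sq w" "v = u \<otimes> w" using v nv by auto
    have "u \<otimes> v = (u \<otimes> u) \<otimes> w" unfolding w(3) using u w by algebra
    moreover have "is_sq (u \<otimes> u)" using u by (auto simp: is_sq_def)
    ultimately show ?thesis using mult w by simp
  qed
  show ?thesis using mult[of u v] quot[of u v] quot[of v u] nn u v m_comm[of u v] by metis
qed

lemma is_sq_zero: "is_sq \<zero>" and is_sq_one: "is_sq \<one>"
  unfolding is_sq_def by (rule bexI[of _ \<zero>], simp_all) (rule bexI[of _ \<one>], simp_all)

lemma nonsquare_exists: "\<exists>z\<in>carrier R. z \<noteq> \<zero> \<and> \<not> is_sq z"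
proof (rule ccontr)
  assume "\<not> ?thesis"
  then have "{z \<in> carrier R - {\<zero>}. is_sq z} = carrier R - {\<zero>}" by auto
  then have "card (carrier R - {\<zero>}) = 0" using card_nonzero_squares by simp
  moreover have "\<one> \<in> carrier R - {\<zero>}" by simp
  ultimately show False using finite_carrier by (metis card_eq_0_iff empty_iff finite_Diff)
qed

text \<open>Otherwise the squares are closed under addition of one, hence contain minus one and
  all differences of squares, which is everything.\<close>
lemma consecutive_square_nonsquare_exists:
  "\<exists>s\<in>carrier R. s \<noteq> \<zero> \<and> is_sq s \<and> s \<oplus> \<one> \<noteq> \<zero> \<and> \<not> is_sq (s \<oplus> \<one>)"
proof (rule ccontr)
  assume contra: "\<not> ?thesis"
  have succ: "is_sq (s \<oplus> \<one>)" if "s \<in> carrier R" "is_sq s" for s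
    using that contra is_sq_zero is_sq_one by (metis l_zero one_closed)
  have cl: "[m] \<cdot> \<one> \<in> carrier R" for m :: nat
    using add.nat_pow_closed[OF one_closed, of m] by (simp add: add_pow_def)
  have sq: "is_sq ([m] \<cdot> \<one>)" for m :: nat
  proof (induction m)
    case 0
    show ?case using is_sq_zero by (simp add: add_pow_def)
  next
    case (Suc m)
    have "[(Suc m)] \<cdot> \<one> = [m] \<cdot> \<one> \<oplus> \<one>" by (simp add: add_pow_def)
    then show ?case using Suc cl[of m] succ by simp
  qed
  \<comment> \<open>In a ring with \<open>m + 1\<close> elements, \<open>m\<close> times one is
    \<open>-1\<close>, and every multiple of one is a square by \<open>sq\<close>.\<close>
  have m1: "is_sq (\<ominus> \<one>)"
  proof -
    obtain m where m: "card (carrier R) = Suc m"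
      using finite_carrier zero_closed by (metis card_gt_0_iff empty_iff gr0_implies_Suc)
    have "[(card (carrier R))] \<cdot> \<one> = \<zero>"
      using add.pow_order_eq_1[of \<one>] by (simp add: add_pow_def order_def)
    then have "[m] \<cdot> \<one> \<oplus> \<one> = \<zero>" by (simp add: m add_pow_def)
    then have "[m] \<cdot> \<one> = \<ominus> \<one>" using minus_equality cl by simp
    then show ?thesis using sq[of m] by simp
  qed
  have "is_sq z" if z: "z \<in> carrier R" for z
  proof -
    \<comment> \<open>One half, used to write \<open>z\<close> as the difference of the squares of
      \<open>(z + 1) / 2\<close> and \<open>(z - 1) / 2\<close>.\<close>
    define h where "h = inv (\<one> \<oplus> \<one>)"
    have h: "h \<in> carrier R" "(\<one> \<oplus> \<one>) \<otimes> h = \<one>"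
      using two_nonzero by (simp_all add: h_def field_Units)
    define a where "a = (z \<oplus> \<one>) \<otimes> h"
    define b where "b = (z \<ominus> \<one>) \<otimes> h"
    have ab: "a \<in> carrier R" "b \<in> carrier R" using z h by (auto simp: a_def b_def)
    have "z = ((\<one> \<oplus> \<one>) \<otimes> h) \<otimes> ((\<one> \<oplus> \<one>) \<otimes> h) \<otimes> z" using h z by simp
    also have "\<dots> = a \<otimes> a \<ominus> b \<otimes> b"
      unfolding a_def b_def using h(1) z by algebra
    finally have zab: "z = a \<otimes> a \<ominus> b \<otimes> b" .
    show ?thesis
    proof (cases "b = \<zero> \<or> z = \<zero>")
      case True
      then show ?thesis using ab zab is_sq_zero
        by (metis a_minus_def integral_iff is_sq_def minus_zero r_zero m_closed)
    next
      case False
      then have bU: "b \<in> Units R" using ab by (simp add: field_Units)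
      define c where "c = a \<otimes> inv b"
      have c: "c \<in> carrier R" "b \<otimes> c = a"
        using ab bU unfolding c_def by (simp_all add: m_lcomm)
      have neg: "is_sq (\<ominus> (t \<otimes> t))" if "t \<in> carrier R" for t
      proof -
        obtain i where i: "i \<in> carrier R" "\<ominus> \<one> = i \<otimes> i" using m1 by (auto simp: is_sq_def)
        have "\<ominus> (t \<otimes> t) = \<ominus> \<one> \<otimes> (t \<otimes> t)" using that by algebra
        also have "\<dots> = (i \<otimes> t) \<otimes> (i \<otimes> t)" unfolding i(2) using i(1) that by algebra
        finally show ?thesis using i that by (auto simp: is_sq_def)
      qed
      have "is_sq (\<ominus> (c \<otimes> c) \<oplus> \<one>)" using neg succ c by simp
      \<comment> \<open>With \<open>c = a / b\<close>, the difference \<open>a^2 - b^2\<close> is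
        \<open>- b^2\<close> times \<open>1 - c^2\<close>: a square times the successor of a
        square.\<close>
      moreover have prod: "z = \<ominus> (b \<otimes> b) \<otimes> (\<ominus> (c \<otimes> c) \<oplus> \<one>)"
        unfolding zab c(2)[symmetric] using ab(2) c(1) by algebra
      moreover have "\<ominus> (b \<otimes> b) \<noteq> \<zero>" "\<ominus> (c \<otimes> c) \<oplus> \<one> \<noteq> \<zero>"
        using False prod ab c by auto
      ultimately show ?thesis using neg[OF ab(2)] ab c is_sq_mult_iff by simp
    qed
  qed
  then show False using nonsquare_exists by blast
qed

end

section \<open>Hadamard matrices from squares\<close>

text \<open>The formula for \<open>t = 0\<close> is the limit of the other one at infinite
  \<open>b\<close>. Replacing \<open>y\<close> by \<open>b y\<close> permutes columns, and
  subtracting \<open>b y^2\<close> changes no row difference;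
  \<open>(x - b y)^2 / (a + b) - b y^2\<close> then tends to \<open>- 2 x y - a y^2\<close>.\<close>

definition (in ring) square_matrix :: "(nat \<Rightarrow> 'a) \<Rightarrow> (nat \<Rightarrow> 'a) \<Rightarrow> 'a \<times> nat \<Rightarrow> 'a \<times> nat \<Rightarrow> 'a" where
  "square_matrix a b = (\<lambda>(x, s) (y, t).
     if t = 0 then \<ominus> ((\<one> \<oplus> \<one>) \<otimes> (x \<otimes> y)) \<ominus> a s \<otimes> (y \<otimes> y)
     else inv (a s \<oplus> b t) \<otimes> ((x \<ominus> y) \<otimes> (x \<ominus> y)))"

context finite_odd_field
begin

section \<open>Counting solutions within one block of columns\<close>

lemma bij_betw_affine:
  assumes d: "d \<in> carrier R" "d \<noteq> \<zero>" and k: "k \<in> carrier R"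
  shows "bij_betw (\<lambda>y. d \<otimes> y \<oplus> k) (carrier R) (carrier R)"
proof -
  have "inj_on (\<lambda>y. d \<otimes> y \<oplus> k) (carrier R)"
    using d k by (auto simp: inj_on_def m_lcancel)
  moreover have "(\<lambda>y. d \<otimes> y \<oplus> k) ` carrier R \<subseteq> carrier R" using d k by auto
  ultimately show ?thesis
    using endo_inj_surj[OF finite_carrier] unfolding bij_betw_def by blast
qed

lemma card_affine_root:
  assumes d: "d \<in> carrier R" "d \<noteq> \<zero>" and k: "k \<in> carrier R"
    and P: "\<And>y. y \<in> carrier R \<Longrightarrow> P y \<longleftrightarrow> d \<otimes> y \<oplus> k = \<zero>"
  shows "card {y \<in> carrier R. P y} = 1"
proof -
  have "{y \<in> carrier R. P y} = {y \<in> carrier R. d \<otimes> y \<oplus> k = \<zero>}" using P by auto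
  also have "card \<dots> = card {z \<in> carrier R. z = \<zero>}"
    by (rule card_bij_betw_Collect[OF bij_betw_affine[OF d k]])
  also have "{z \<in> carrier R. z = \<zero>} = {\<zero>}" by auto
  finally show ?thesis by simp
qed

lemma card_affine_square:
  assumes d: "d \<in> carrier R" "d \<noteq> \<zero>" and k: "k \<in> carrier R"
    and P: "\<And>y. y \<in> carrier R \<Longrightarrow> P y \<longleftrightarrow> (d \<otimes> y \<oplus> k) \<otimes> (d \<otimes> y \<oplus> k) = z"
  shows "card {y \<in> carrier R. P y} = num_sqrt z"
proof -
  have "{y \<in> carrier R. P y} = {y \<in> carrier R. (d \<otimes> y \<oplus> k) \<otimes> (d \<otimes> y \<oplus> k) = z}" using P by auto
  also have "card \<dots> = num_sqrt z" unfolding num_sqrt_def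
    by (rule card_bij_betw_Collect[OF bij_betw_affine[OF d k]])
  finally show ?thesis .
qed

lemma eq_iff_minus_zero: "u = v \<longleftrightarrow> u \<ominus> v = \<zero>" if "u \<in> carrier R" "v \<in> carrier R"
  using that by simp

lemma inv_mult_eq_iff:
  assumes "e \<in> carrier R" "e \<noteq> \<zero>" "e' \<in> carrier R" "e' \<noteq> \<zero>"
    and "A \<in> carrier R" "B \<in> carrier R" "g \<in> carrier R"
  shows "inv e \<otimes> A = g \<oplus> inv e' \<otimes> B \<longleftrightarrow> e' \<otimes> A = e \<otimes> e' \<otimes> g \<oplus> e \<otimes> B"
proof -
  have U: "e \<in> Units R" "e' \<in> Units R" using assms by (auto simp: field_Units)
  have "e \<otimes> e' \<noteq> \<zero>" using assms integral_iff by simp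
  then have "inv e \<otimes> A = g \<oplus> inv e' \<otimes> B \<longleftrightarrow>
      (e \<otimes> e') \<otimes> (inv e \<otimes> A) = (e \<otimes> e') \<otimes> (g \<oplus> inv e' \<otimes> B)"
    using assms U by (simp add: m_lcancel)
  also have "(e \<otimes> e') \<otimes> (inv e \<otimes> A) = (e \<otimes> inv e) \<otimes> e' \<otimes> A"
    using assms Units_inv_closed[OF U(1)] by (simp add: m_ac)
  also have "(e \<otimes> e') \<otimes> (g \<oplus> inv e' \<otimes> B) = e \<otimes> e' \<otimes> g \<oplus> (e' \<otimes> inv e') \<otimes> e \<otimes> B"
    using assms Units_inv_closed[OF U(2)] by (simp add: m_ac r_distr)
  finally show ?thesis using assms U by simp
qed

text \<open>The terms quadratic in \<open>y\<close> cancel. The remaining linear equation has slope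
  \<open>2 (x - x')\<close>, nonzero in odd characteristic.\<close>

lemma card_column_finite_same:
  assumes e: "e \<in> carrier R" "e \<noteq> \<zero>" and x: "x \<in> carrier R" "x' \<in> carrier R" "x \<noteq> x'"
    and g: "g \<in> carrier R"
  shows "card {y \<in> carrier R. inv e \<otimes> ((x \<ominus> y) \<otimes> (x \<ominus> y)) = g \<oplus> inv e \<otimes> ((x' \<ominus> y) \<otimes> (x' \<ominus> y))} = 1"
proof (rule card_affine_root)
  define u where "u = x \<ominus> x'"
  have u: "u \<in> carrier R" "u \<noteq> \<zero>" using x by (auto simp: u_def)
  show "(\<one> \<oplus> \<one>) \<otimes> u \<in> carrier R" "(\<one> \<oplus> \<one>) \<otimes> u \<noteq> \<zero>" "e \<otimes> g \<ominus> u \<otimes> (x \<oplus> x') \<in> carrier R"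
    using u two_nonzero integral_iff e g x by auto
  fix y assume y: "y \<in> carrier R"
  define A B where "A = (x \<ominus> y) \<otimes> (x \<ominus> y)" and "B = (x' \<ominus> y) \<otimes> (x' \<ominus> y)"
  have AB: "A \<in> carrier R" "B \<in> carrier R" using x y by (auto simp: A_def B_def)
  have "inv e \<otimes> A = g \<oplus> inv e \<otimes> B \<longleftrightarrow> e \<otimes> A = e \<otimes> e \<otimes> g \<oplus> e \<otimes> B"
    using e AB g by (intro inv_mult_eq_iff)
  also have "\<dots> \<longleftrightarrow> e \<otimes> A = e \<otimes> (e \<otimes> g \<oplus> B)" using e AB g by (simp add: r_distr m_assoc)
  also have "\<dots> \<longleftrightarrow> e \<otimes> g \<oplus> B = A" using e AB g by (auto simp: m_lcancel)
  also have "\<dots> \<longleftrightarrow> (e \<otimes> g \<oplus> B) \<ominus> A = \<zero>" using e AB g by (intro eq_iff_minus_zero) auto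
  also have "(e \<otimes> g \<oplus> B) \<ominus> A = ((\<one> \<oplus> \<one>) \<otimes> u) \<otimes> y \<oplus> (e \<otimes> g \<ominus> u \<otimes> (x \<oplus> x'))"
    unfolding A_def B_def u_def using e g x y by algebra
  finally show "inv e \<otimes> ((x \<ominus> y) \<otimes> (x \<ominus> y)) = g \<oplus> inv e \<otimes> ((x' \<ominus> y) \<otimes> (x' \<ominus> y)) \<longleftrightarrow>
      ((\<one> \<oplus> \<one>) \<otimes> u) \<otimes> y \<oplus> (e \<otimes> g \<ominus> u \<otimes> (x \<oplus> x')) = \<zero>" unfolding A_def B_def .
qed

lemma card_column_infinite_same:
  assumes c: "c \<in> carrier R" and x: "x \<in> carrier R" "x' \<in> carrier R" "x \<noteq> x'" and g: "g \<in> carrier R"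
  shows "card {y \<in> carrier R. \<ominus> ((\<one> \<oplus> \<one>) \<otimes> (x \<otimes> y)) \<ominus> c \<otimes> (y \<otimes> y)
    = g \<oplus> (\<ominus> ((\<one> \<oplus> \<one>) \<otimes> (x' \<otimes> y)) \<ominus> c \<otimes> (y \<otimes> y))} = 1"
proof (rule card_affine_root)
  define u where "u = x \<ominus> x'"
  have u: "u \<in> carrier R" "u \<noteq> \<zero>" using x by (auto simp: u_def)
  show "(\<one> \<oplus> \<one>) \<otimes> u \<in> carrier R" "(\<one> \<oplus> \<one>) \<otimes> u \<noteq> \<zero>" "g \<in> carrier R"
    using u two_nonzero integral_iff g by auto
  fix y assume y: "y \<in> carrier R"
  define A B where "A = \<ominus> ((\<one> \<oplus> \<one>) \<otimes> (x \<otimes> y)) \<ominus> c \<otimes> (y \<otimes> y)"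
    and "B = \<ominus> ((\<one> \<oplus> \<one>) \<otimes> (x' \<otimes> y)) \<ominus> c \<otimes> (y \<otimes> y)"
  have AB: "A \<in> carrier R" "B \<in> carrier R" using x y c by (auto simp: A_def B_def)
  have "A = g \<oplus> B \<longleftrightarrow> g \<oplus> B = A" by auto
  also have "\<dots> \<longleftrightarrow> (g \<oplus> B) \<ominus> A = \<zero>" using AB g by (intro eq_iff_minus_zero) auto
  also have "(g \<oplus> B) \<ominus> A = ((\<one> \<oplus> \<one>) \<otimes> u) \<otimes> y \<oplus> g"
    unfolding A_def B_def u_def using g x y c by algebra
  finally show "\<ominus> ((\<one> \<oplus> \<one>) \<otimes> (x \<otimes> y)) \<ominus> c \<otimes> (y \<otimes> y)
    = g \<oplus> (\<ominus> ((\<one> \<oplus> \<one>) \<otimes> (x' \<otimes> y)) \<ominus> c \<otimes> (y \<otimes> y)) \<longleftrightarrow>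
    ((\<one> \<oplus> \<one>) \<otimes> u) \<otimes> y \<oplus> g = \<zero>" unfolding A_def B_def .
qed

text \<open>Cleared of denominators, the equation has leading coefficient \<open>e - e'\<close>;
  multiplying by it completes the square. For \<open>e = a s + b t\<close> and
  \<open>e' = a s' + b t\<close> this coefficient is free of \<open>t\<close>, so the block enters
  the result through \<open>e e'\<close> alone.\<close>

lemma card_column_finite_distinct:
  assumes e: "e \<in> carrier R" "e \<noteq> \<zero>" "e' \<in> carrier R" "e' \<noteq> \<zero>" "e \<noteq> e'"
    and x: "x \<in> carrier R" "x' \<in> carrier R" and g: "g \<in> carrier R"
  shows "card {y \<in> carrier R. inv e \<otimes> ((x \<ominus> y) \<otimes> (x \<ominus> y)) = g \<oplus> inv e' \<otimes> ((x' \<ominus> y) \<otimes> (x' \<ominus> y))}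
    = num_sqrt ((e \<otimes> e') \<otimes> ((x \<ominus> x') \<otimes> (x \<ominus> x') \<ominus> g \<otimes> (e \<ominus> e')))"
proof (rule card_affine_square)
  define d where "d = e \<ominus> e'"
  have d: "d \<in> carrier R" "d \<noteq> \<zero>" using e by (auto simp: d_def)
  show "d \<in> carrier R" "d \<noteq> \<zero>" "e' \<otimes> x \<ominus> e \<otimes> x' \<in> carrier R" using d e x by auto
  fix y assume y: "y \<in> carrier R"
  define A B where "A = x \<ominus> y" and "B = x' \<ominus> y"
  have AB: "A \<in> carrier R" "B \<in> carrier R" using x y by (auto simp: A_def B_def)
  define Z where "Z = e' \<otimes> A \<ominus> e \<otimes> B"
  have Z: "Z \<in> carrier R" using e AB by (simp add: Z_def)
  define w where "w = (e \<otimes> e') \<otimes> ((A \<ominus> B) \<otimes> (A \<ominus> B) \<ominus> g \<otimes> d)"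
  have w: "w \<in> carrier R" using e AB g d by (simp add: w_def)
  have Zy: "d \<otimes> y \<oplus> (e' \<otimes> x \<ominus> e \<otimes> x') = Z"
    unfolding Z_def A_def B_def d_def using e x y by algebra
  have xx: "x \<ominus> x' = A \<ominus> B" unfolding A_def B_def using x y by algebra
  let ?E = "e \<otimes> e' \<otimes> g \<oplus> e \<otimes> (B \<otimes> B) \<ominus> e' \<otimes> (A \<otimes> A)"
  have "inv e \<otimes> (A \<otimes> A) = g \<oplus> inv e' \<otimes> (B \<otimes> B) \<longleftrightarrow>
      e' \<otimes> (A \<otimes> A) = e \<otimes> e' \<otimes> g \<oplus> e \<otimes> (B \<otimes> B)"
    using e AB g by (intro inv_mult_eq_iff) auto
  also have "\<dots> \<longleftrightarrow> e \<otimes> e' \<otimes> g \<oplus> e \<otimes> (B \<otimes> B) = e' \<otimes> (A \<otimes> A)" by auto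
  also have "\<dots> \<longleftrightarrow> ?E = \<zero>" using e AB g by (intro eq_iff_minus_zero) auto
  also have "\<dots> \<longleftrightarrow> d \<otimes> ?E = \<zero>" using d e AB g integral_iff by simp
  also have "d \<otimes> ?E = Z \<otimes> Z \<ominus> w"
    unfolding Z_def w_def d_def using e AB g by algebra
  also have "Z \<otimes> Z \<ominus> w = \<zero> \<longleftrightarrow> Z \<otimes> Z = w" using Z w by (intro eq_iff_minus_zero[symmetric]) auto
  finally show "inv e \<otimes> ((x \<ominus> y) \<otimes> (x \<ominus> y)) = g \<oplus> inv e' \<otimes> ((x' \<ominus> y) \<otimes> (x' \<ominus> y)) \<longleftrightarrow>
      (d \<otimes> y \<oplus> (e' \<otimes> x \<ominus> e \<otimes> x')) \<otimes> (d \<otimes> y \<oplus> (e' \<otimes> x \<ominus> e \<otimes> x'))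
      = (e \<otimes> e') \<otimes> ((x \<ominus> x') \<otimes> (x \<ominus> x') \<ominus> g \<otimes> (e \<ominus> e'))"
    unfolding Zy xx w_def A_def[symmetric] B_def[symmetric] d_def[symmetric] .
qed

text \<open>Completing the square leaves the value common to the finite blocks, now without the
  factor \<open>e e'\<close>: the block at infinity acts as one in which that product is a
  square.\<close>

lemma card_column_infinite_distinct:
  assumes c: "c \<in> carrier R" "c' \<in> carrier R" "c \<noteq> c'"
    and x: "x \<in> carrier R" "x' \<in> carrier R" and g: "g \<in> carrier R"
  shows "card {y \<in> carrier R. \<ominus> ((\<one> \<oplus> \<one>) \<otimes> (x \<otimes> y)) \<ominus> c \<otimes> (y \<otimes> y)
    = g \<oplus> (\<ominus> ((\<one> \<oplus> \<one>) \<otimes> (x' \<otimes> y)) \<ominus> c' \<otimes> (y \<otimes> y))}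
    = num_sqrt ((x \<ominus> x') \<otimes> (x \<ominus> x') \<ominus> g \<otimes> (c \<ominus> c'))"
proof (rule card_affine_square)
  define d u where "d = c \<ominus> c'" and "u = x \<ominus> x'"
  have d: "d \<in> carrier R" "d \<noteq> \<zero>" using c by (auto simp: d_def)
  have u: "u \<in> carrier R" using x by (simp add: u_def)
  show "d \<in> carrier R" "d \<noteq> \<zero>" "u \<in> carrier R" by fact+
  fix y assume y: "y \<in> carrier R"
  define A B where "A = \<ominus> ((\<one> \<oplus> \<one>) \<otimes> (x \<otimes> y)) \<ominus> c \<otimes> (y \<otimes> y)"
    and "B = \<ominus> ((\<one> \<oplus> \<one>) \<otimes> (x' \<otimes> y)) \<ominus> c' \<otimes> (y \<otimes> y)"
  have AB: "A \<in> carrier R" "B \<in> carrier R" using x y c by (auto simp: A_def B_def)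
  have E: "(g \<oplus> B) \<ominus> A = g \<oplus> (\<one> \<oplus> \<one>) \<otimes> (u \<otimes> y) \<oplus> d \<otimes> (y \<otimes> y)"
    unfolding A_def B_def u_def d_def using g x y c by algebra
  have "A = g \<oplus> B \<longleftrightarrow> g \<oplus> B = A" by auto
  also have "\<dots> \<longleftrightarrow> (g \<oplus> B) \<ominus> A = \<zero>" using AB g by (intro eq_iff_minus_zero) auto
  also have "\<dots> \<longleftrightarrow> d \<otimes> ((g \<oplus> B) \<ominus> A) = \<zero>" using d AB g integral_iff by simp
  also have "d \<otimes> ((g \<oplus> B) \<ominus> A) = (d \<otimes> y \<oplus> u) \<otimes> (d \<otimes> y \<oplus> u) \<ominus> (u \<otimes> u \<ominus> g \<otimes> d)"
    unfolding E using d u y g by algebra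
  also have "\<dots> = \<zero> \<longleftrightarrow> (d \<otimes> y \<oplus> u) \<otimes> (d \<otimes> y \<oplus> u) = u \<otimes> u \<ominus> g \<otimes> d"
    using d u y g by (intro eq_iff_minus_zero[symmetric]) auto
  finally show "\<ominus> ((\<one> \<oplus> \<one>) \<otimes> (x \<otimes> y)) \<ominus> c \<otimes> (y \<otimes> y)
    = g \<oplus> (\<ominus> ((\<one> \<oplus> \<one>) \<otimes> (x' \<otimes> y)) \<ominus> c' \<otimes> (y \<otimes> y)) \<longleftrightarrow>
    (d \<otimes> y \<oplus> u) \<otimes> (d \<otimes> y \<oplus> u) = (x \<ominus> x') \<otimes> (x \<ominus> x') \<ominus> g \<otimes> (c \<ominus> c')"
    unfolding A_def B_def u_def d_def .
qed

text \<open>Completing the square turns every column block into a count of square roots of a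
  common value times \<open>(a s \<oplus> b t) \<otimes> (a s' \<oplus> b t)\<close>; the balance hypothesis makes these counts
  cancel. The block \<open>t = 0\<close> plays the role of a point at infinity.\<close>
lemma generalized_hadamard_square_matrix:
  assumes n: "n \<ge> 1"
    and a: "\<And>s. s < n \<Longrightarrow> a s \<in> carrier R"
    and b: "\<And>t. 0 < t \<Longrightarrow> t < n \<Longrightarrow> b t \<in> carrier R"
    and nz: "\<And>s t. s < n \<Longrightarrow> 0 < t \<Longrightarrow> t < n \<Longrightarrow> a s \<oplus> b t \<noteq> \<zero>"
    and balance: "\<And>s s'. s < n \<Longrightarrow> s' < n \<Longrightarrow> s \<noteq> s' \<Longrightarrow>
      2 * card {t \<in> {1..<n}. is_sq (a s \<oplus> b t) \<longleftrightarrow> is_sq (a s' \<oplus> b t)} + 2 = n"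
  shows "generalized_hadamard (add_monoid R) (carrier R \<times> {..<n}) (carrier R \<times> {..<n})
    (square_matrix a b) n"
proof -
  let ?M = "square_matrix a b"
  have closed: "?M (x, s) (y, t) \<in> carrier R" if "x \<in> carrier R" "s < n" "y \<in> carrier R" "t < n" for x s y t
  proof (cases "t = 0")
    case False
    then have "a s \<oplus> b t \<in> Units R" using that a b nz by (simp add: field_Units)
    then show ?thesis using that False by (simp add: square_matrix_def)
  qed (use that a in \<open>simp add: square_matrix_def\<close>)
  have count: "card {j \<in> carrier R \<times> {..<n}. ?M (x, s) j = g \<oplus> ?M (x', s') j} = n"
    if x: "x \<in> carrier R" "x' \<in> carrier R" and s: "s < n" "s' < n" and ne: "(x, s) \<noteq> (x', s')"
      and g: "g \<in> carrier R" for x s x' s' g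
  proof -
    define cnt where "cnt t = card {y \<in> carrier R. ?M (x, s) (y, t) = g \<oplus> ?M (x', s') (y, t)}" for t
    have "card {j \<in> carrier R \<times> {..<n}. ?M (x, s) j = g \<oplus> ?M (x', s') j} = (\<Sum>t<n. cnt t)"
      unfolding cnt_def by (rule card_Collect_Times) (use finite_carrier in simp_all)
    also have "\<dots> = n"
    proof (cases "s = s'")
      case True
      then have "x \<noteq> x'" using ne by simp
      then have "cnt t = 1" if "t < n" for t
        using that True x s g a b nz
          card_column_infinite_same[of "a s" x x' g] card_column_finite_same[of "a s \<oplus> b t" x x' g]
        by (cases "t = 0") (simp_all add: cnt_def square_matrix_def)
      then show ?thesis by simp
    next
      case False
      define e where "e t = (a s \<oplus> b t) \<otimes> (a s' \<oplus> b t)" for t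
      define w where "w = (x \<ominus> x') \<otimes> (x \<ominus> x') \<ominus> g \<otimes> (a s \<ominus> a s')"
      have w: "w \<in> carrier R" using x g a s by (simp add: w_def)
      have e: "e t \<in> carrier R" "e t \<noteq> \<zero>" if "t \<in> {1..<n}" for t
        using that a b nz s integral_iff by (auto simp: e_def)
      have sq_e: "is_sq (e t) \<longleftrightarrow> (is_sq (a s \<oplus> b t) \<longleftrightarrow> is_sq (a s' \<oplus> b t))" if "t \<in> {1..<n}" for t
        unfolding e_def using that a b nz s by (intro is_sq_mult_iff) auto
      define S where "S = {t \<in> {1..<n}. is_sq (e t)}"
      have S: "2 * card S + 2 = n"
        using balance[OF s False] sq_e by (simp add: S_def cong: conj_cong Collect_cong)
      \<comment> \<open>Equal parameters would make all \<open>n - 1\<close> finite blocks agree,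
        and twice that number plus two is \<open>2 n\<close> instead of \<open>n\<close>.\<close>
      have neq: "a s \<noteq> a s'"
      proof
        assume "a s = a s'"
        then have "S = {1..<n}" using sq_e by (auto simp: S_def)
        then show False using S by simp
      qed
      have cnt0: "cnt 0 = num_sqrt w"
        using card_column_infinite_distinct[of "a s" "a s'" x x' g] a s x g neq
        by (simp add: cnt_def square_matrix_def w_def)
      have cntt: "cnt t = num_sqrt (e t \<otimes> w)" if "t \<in> {1..<n}" for t
      proof -
        have c: "a s \<in> carrier R" "a s' \<in> carrier R" "b t \<in> carrier R" using a b s that by auto
        have "a s \<oplus> b t \<noteq> a s' \<oplus> b t" using neq c by simp
        moreover have "(a s \<oplus> b t) \<ominus> (a s' \<oplus> b t) = a s \<ominus> a s'" using c by algebra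
        ultimately show ?thesis
          using card_column_finite_distinct[of "a s \<oplus> b t" "a s' \<oplus> b t" x x' g] c s x g nz that
          by (simp add: cnt_def square_matrix_def w_def e_def)
      qed
      have "{..<n} = insert 0 {1..<n}" using n by auto
      then have sum: "(\<Sum>t<n. cnt t) = num_sqrt w + (\<Sum>t\<in>{1..<n}. num_sqrt (e t \<otimes> w))"
        using cnt0 cntt by simp
      show ?thesis
      \<comment> \<open>For \<open>w = 0\<close> each of the \<open>n\<close> blocks has one
        solution. For a nonzero square the total is \<open>2 + 2 card S\<close>, for a nonsquare it
        is \<open>2 (n - 1 - card S)\<close>; by balance both equal \<open>n\<close>.\<close>
      proof (cases "w = \<zero>")
        case True
        then have "(\<Sum>t\<in>{1..<n}. num_sqrt (e t \<otimes> w)) = (\<Sum>t\<in>{1..<n}. 1)"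
          using e num_sqrt_zero by (intro sum.cong) auto
        then show ?thesis using sum True num_sqrt_zero n by simp
      next
        case False
        have "num_sqrt (e t \<otimes> w) = (if is_sq (e t) \<longleftrightarrow> is_sq w then 2 else 0)" if "t \<in> {1..<n}" for t
          using num_sqrt_nonzero[of "e t \<otimes> w"] is_sq_mult_iff[of "e t" w] e[OF that] w False integral_iff
          by simp
        then have "(\<Sum>t\<in>{1..<n}. num_sqrt (e t \<otimes> w)) = (\<Sum>t\<in>{1..<n}. if is_sq (e t) \<longleftrightarrow> is_sq w then 2 else 0)"
          by (intro sum.cong) auto
        also have "\<dots> = 2 * card {t \<in> {1..<n}. is_sq (e t) \<longleftrightarrow> is_sq w}"
          by (simp add: sum.inter_filter[symmetric])
        also have "{t \<in> {1..<n}. is_sq (e t) \<longleftrightarrow> is_sq w} = (if is_sq w then S else {1..<n} - S)"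
          by (auto simp: S_def)
        finally have *: "(\<Sum>t\<in>{1..<n}. num_sqrt (e t \<otimes> w)) = 2 * card (if is_sq w then S else {1..<n} - S)" .
        have "card ({1..<n} - S) = n - 1 - card S"
          by (subst card_Diff_subset) (auto simp: S_def)
        then show ?thesis
          using sum S * num_sqrt_nonzero[OF w False] by (cases "is_sq w") simp_all
      qed
    qed
    finally show ?thesis .
  qed
  show ?thesis
    unfolding generalized_hadamard_def
    using finite_carrier closed count by (auto simp: card_cartesian_product)
qed

section \<open>Choice of the parameters for index 2 and index 4\<close>

lemma generalized_hadamard_2_exists:
  "\<exists>M. generalized_hadamard (add_monoid R) (carrier R \<times> {..<2::nat}) (carrier R \<times> {..<2::nat}) M 2"
proof -
  obtain c where c: "c \<in> carrier R" "c \<noteq> \<zero>" "\<not> is_sq c" using nonsquare_exists by blast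
  \<comment> \<open>With \<open>b = 0\<close> the signs are those of a square and of a nonsquare;
    next to the column of ones they form the Hadamard matrix of order 2.\<close>
  define a where "a s = (if s = 0 then \<one> else c)" for s :: nat
  have "generalized_hadamard (add_monoid R) (carrier R \<times> {..<2}) (carrier R \<times> {..<2})
    (square_matrix a (\<lambda>_. \<zero>)) 2"
  proof (rule generalized_hadamard_square_matrix)
    fix s s' :: nat assume "s < 2" "s' < 2" "s \<noteq> s'"
    then have "is_sq (a s \<oplus> \<zero>) \<noteq> is_sq (a s' \<oplus> \<zero>)"
      using c is_sq_one by (auto simp: a_def less_2_cases_iff)
    then show "2 * card {t \<in> {1..<2::nat}. is_sq (a s \<oplus> \<zero>) \<longleftrightarrow> is_sq (a s' \<oplus> \<zero>)} + 2 = 2"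
      by simp
  qed (use c in \<open>auto simp: a_def\<close>)
  then show ?thesis by blast
qed

text \<open>The values \<open>a s\<close> are the orbit \<open>x, l / x, (x - l) / (x - 1), l (x - 1) / (x - l)\<close> of \<open>x\<close> under
  the Klein four-group of projective maps that permute \<open>0, 1, l\<close> and infinity. Up to squares, every
  \<open>a s \<oplus> b t\<close> is then a product of some of \<open>-1, x, x - 1, x - l, l, 1 - l\<close>. For two rows, the product
  over the three finite \<open>t\<close> of \<open>(a s \<oplus> b t) \<otimes> (a s' \<oplus> b t)\<close> is a square, so exactly one or all three factors
  are squares; the hypotheses exclude the latter, one for each involution in the group.\<close>
lemma generalized_hadamard_4:
  assumes x: "x \<in> carrier R" "x \<noteq> \<zero>" "x \<noteq> \<one>" "x \<noteq> l"
    and l: "l \<in> carrier R" "l \<noteq> \<zero>" "l \<noteq> \<one>"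
    and sq: "\<not> (is_sq l \<and> (is_sq (x \<ominus> l) \<longleftrightarrow> (is_sq (\<ominus> \<one>) \<longleftrightarrow> is_sq x \<longleftrightarrow> is_sq (x \<ominus> \<one>))))"
      "\<not> (is_sq (\<one> \<ominus> l) \<and> (is_sq (x \<ominus> l) \<longleftrightarrow> (is_sq x \<longleftrightarrow> is_sq (x \<ominus> \<one>))))"
      "\<not> ((is_sq (\<ominus> \<one>) \<longleftrightarrow> is_sq l \<longleftrightarrow> is_sq (\<one> \<ominus> l)) \<and>
          (is_sq (x \<ominus> l) \<longleftrightarrow> (is_sq l \<longleftrightarrow> is_sq x \<longleftrightarrow> is_sq (x \<ominus> \<one>))))"
  shows "\<exists>M. generalized_hadamard (add_monoid R) (carrier R \<times> {..<4::nat}) (carrier R \<times> {..<4::nat}) M 4"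
proof -
  have sub: "x \<ominus> \<one> \<in> carrier R" "x \<ominus> \<one> \<noteq> \<zero>" "x \<ominus> l \<in> carrier R" "x \<ominus> l \<noteq> \<zero>"
      "\<one> \<ominus> l \<in> carrier R" "\<one> \<ominus> l \<noteq> \<zero>" "\<ominus> \<one> \<in> carrier R" "\<ominus> \<one> \<noteq> \<zero>"
    using x l one_not_zero by auto
  have U: "x \<in> Units R" "x \<ominus> \<one> \<in> Units R" "x \<ominus> l \<in> Units R" using x sub by (auto simp: field_Units)
  define a1 a2 a3 where "a1 = l \<otimes> inv x" and "a2 = (x \<ominus> l) \<otimes> inv (x \<ominus> \<one>)"
    and "a3 = l \<otimes> (x \<ominus> \<one>) \<otimes> inv (x \<ominus> l)"
  have ac: "a1 \<in> carrier R" "a2 \<in> carrier R" "a3 \<in> carrier R"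
    using U sub x l by (auto simp: a1_def a2_def a3_def)
  have am: "a1 \<otimes> x = l" "a2 \<otimes> (x \<ominus> \<one>) = x \<ominus> l" "a3 \<otimes> (x \<ominus> l) = l \<otimes> (x \<ominus> \<one>)"
    using U sub x l by (simp_all add: a1_def a2_def a3_def m_assoc)
  \<comment> \<open>The \<open>a s\<close> are quotients; from \<open>p d = r\<close> the character
    of \<open>p\<close> is read off without handling inverses.\<close>
  have key: "p \<noteq> \<zero> \<and> (is_sq p \<longleftrightarrow> (is_sq r \<longleftrightarrow> is_sq d))"
    if "p \<otimes> d = r" "p \<in> carrier R" "d \<in> carrier R" "d \<noteq> \<zero>" "r \<noteq> \<zero>" for p d r
    using that is_sq_mult_iff[of p d] by (cases "p = \<zero>") auto
  have mult: "u \<otimes> v \<noteq> \<zero> \<and> (is_sq (u \<otimes> v) \<longleftrightarrow> (is_sq u \<longleftrightarrow> is_sq v))"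
    if "u \<in> carrier R" "u \<noteq> \<zero>" "v \<in> carrier R" "v \<noteq> \<zero>" for u v
    using that is_sq_mult_iff integral_iff by simp
  have e11: "(a1 \<oplus> \<ominus> \<one>) \<otimes> x = \<ominus> \<one> \<otimes> (x \<ominus> l)"
  proof -
    have "(a1 \<oplus> \<ominus> \<one>) \<otimes> x = a1 \<otimes> x \<ominus> x" using ac x by algebra
    then show ?thesis unfolding am using x l by simp algebra
  qed
  have e12: "(a1 \<oplus> \<ominus> l) \<otimes> x = \<ominus> \<one> \<otimes> (l \<otimes> (x \<ominus> \<one>))"
  proof -
    have "(a1 \<oplus> \<ominus> l) \<otimes> x = a1 \<otimes> x \<ominus> l \<otimes> x" using ac x l by algebra
    then show ?thesis unfolding am using x l by simp algebra
  qed
  have e21: "(a2 \<oplus> \<ominus> \<one>) \<otimes> (x \<ominus> \<one>) = \<one> \<ominus> l"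
  proof -
    have "(a2 \<oplus> \<ominus> \<one>) \<otimes> (x \<ominus> \<one>) = a2 \<otimes> (x \<ominus> \<one>) \<ominus> (x \<ominus> \<one>)" using ac x by algebra
    then show ?thesis unfolding am using x l by simp algebra
  qed
  have e22: "(a2 \<oplus> \<ominus> l) \<otimes> (x \<ominus> \<one>) = x \<otimes> (\<one> \<ominus> l)"
  proof -
    have "(a2 \<oplus> \<ominus> l) \<otimes> (x \<ominus> \<one>) = a2 \<otimes> (x \<ominus> \<one>) \<ominus> l \<otimes> (x \<ominus> \<one>)" using ac x l by algebra
    then show ?thesis unfolding am using x l by simp algebra
  qed
  have e31: "(a3 \<oplus> \<ominus> \<one>) \<otimes> (x \<ominus> l) = \<ominus> \<one> \<otimes> (x \<otimes> (\<one> \<ominus> l))"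
  proof -
    have "(a3 \<oplus> \<ominus> \<one>) \<otimes> (x \<ominus> l) = a3 \<otimes> (x \<ominus> l) \<ominus> (x \<ominus> l)" using ac x l by algebra
    then show ?thesis unfolding am using x l by simp algebra
  qed
  have e32: "(a3 \<oplus> \<ominus> l) \<otimes> (x \<ominus> l) = \<ominus> \<one> \<otimes> (l \<otimes> (\<one> \<ominus> l))"
  proof -
    have "(a3 \<oplus> \<ominus> l) \<otimes> (x \<ominus> l) = a3 \<otimes> (x \<ominus> l) \<ominus> l \<otimes> (x \<ominus> l)" using ac x l by algebra
    then show ?thesis unfolding am using x l by simp algebra
  qed
  note m = mult[OF l(1,2) sub(1,2)] mult[OF sub(7,8,3,4)] mult[OF x(1,2) sub(5,6)] mult[OF l(1,2) sub(5,6)]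
  have cl: "l \<otimes> (x \<ominus> \<one>) \<in> carrier R" "x \<otimes> (\<one> \<ominus> l) \<in> carrier R" "l \<otimes> (\<one> \<ominus> l) \<in> carrier R"
    using x l sub by auto
  note m' = mult[OF sub(7,8) cl(1) conjunct1[OF m(1)]] mult[OF sub(7,8) cl(2) conjunct1[OF m(3)]]
    mult[OF sub(7,8) cl(3) conjunct1[OF m(4)]]
  have cl': "a1 \<oplus> \<ominus> \<one> \<in> carrier R" "a1 \<oplus> \<ominus> l \<in> carrier R" "a2 \<oplus> \<ominus> \<one> \<in> carrier R"
    "a2 \<oplus> \<ominus> l \<in> carrier R" "a3 \<oplus> \<ominus> \<one> \<in> carrier R" "a3 \<oplus> \<ominus> l \<in> carrier R"
    using ac l by auto
  note k0 = sub(2)[unfolded a_minus_def] sub(4)[unfolded a_minus_def]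
  note k1 = key[OF am(1) ac(1) x(1,2) l(2)] key[OF e11 cl'(1) x(1,2) conjunct1[OF m(2)]]
    key[OF e12 cl'(2) x(1,2) conjunct1[OF m'(1)]]
  note k2 = key[OF am(2) ac(2) sub(1,2,4)] key[OF e21 cl'(3) sub(1,2,6)]
    key[OF e22 cl'(4) sub(1,2) conjunct1[OF m(3)]]
  note k3 = key[OF am(3) ac(3) sub(3,4) conjunct1[OF m(1)]] key[OF e31 cl'(5) sub(3,4) conjunct1[OF m'(2)]]
    key[OF e32 cl'(6) sub(3,4) conjunct1[OF m'(3)]]
  \<comment> \<open>These are the abscissas of the translates, by the 2-torsion points, of a point
    on \<open>y^2 = x (x - 1) (x - l)\<close> or on its quadratic twist. The cubic therefore keeps
    its square class along the orbit, and the \<open>b t\<close> subtract its three roots.\<close>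
  define a where "a s = (if s = 0 then x else if s = 1 then a1 else if s = 2 then a2 else a3)" for s :: nat
  define b where "b t = (if t = 1 then \<zero> else if t = 2 then \<ominus> \<one> else \<ominus> l)" for t :: nat
  have bc: "b t \<in> carrier R" for t using l by (simp add: b_def)
  have ac': "a s \<in> carrier R" for s using ac x by (simp add: a_def)
  have lt4: "s < 4 \<longleftrightarrow> s = 0 \<or> s = 1 \<or> s = 2 \<or> s = 3" for s :: nat by auto
  have set4: "{1..<4} = {1, 2, 3::nat}" by auto
  have val: "a 0 \<oplus> b 1 = x" "a 0 \<oplus> b 2 = x \<oplus> \<ominus> \<one>" "a 0 \<oplus> b 3 = x \<oplus> \<ominus> l"
    "a 1 \<oplus> b 1 = a1" "a 1 \<oplus> b 2 = a1 \<oplus> \<ominus> \<one>" "a 1 \<oplus> b 3 = a1 \<oplus> \<ominus> l"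
    "a 2 \<oplus> b 1 = a2" "a 2 \<oplus> b 2 = a2 \<oplus> \<ominus> \<one>" "a 2 \<oplus> b 3 = a2 \<oplus> \<ominus> l"
    "a 3 \<oplus> b 1 = a3" "a 3 \<oplus> b 2 = a3 \<oplus> \<ominus> \<one>" "a 3 \<oplus> b 3 = a3 \<oplus> \<ominus> l"
    using ac x by (simp_all add: a_def b_def)
  have nz: "a s \<oplus> b t \<noteq> \<zero>" if "s < 4" "0 < t" "t < 4" for s t
  proof -
    have "t = 1 \<or> t = 2 \<or> t = 3" using that by auto
    then show ?thesis
      using that(1) unfolding lt4
      by (elim disjE) (simp_all only: val x(2) k0 k1[THEN conjunct1] k2[THEN conjunct1] k3[THEN conjunct1] simp_thms)
  qed
  have chi: "is_sq (a 0 \<oplus> b 1) \<longleftrightarrow> is_sq x"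
    "is_sq (a 0 \<oplus> b 2) \<longleftrightarrow> is_sq (x \<ominus> \<one>)"
    "is_sq (a 0 \<oplus> b 3) \<longleftrightarrow> is_sq (x \<ominus> l)"
    "is_sq (a 1 \<oplus> b 1) \<longleftrightarrow> (is_sq l \<longleftrightarrow> is_sq x)"
    "is_sq (a 1 \<oplus> b 2) \<longleftrightarrow> ((is_sq (\<ominus> \<one>) \<longleftrightarrow> is_sq (x \<ominus> l)) \<longleftrightarrow> is_sq x)"
    "is_sq (a 1 \<oplus> b 3) \<longleftrightarrow> ((is_sq (\<ominus> \<one>) \<longleftrightarrow> (is_sq l \<longleftrightarrow> is_sq (x \<ominus> \<one>))) \<longleftrightarrow> is_sq x)"
    "is_sq (a 2 \<oplus> b 1) \<longleftrightarrow> (is_sq (x \<ominus> l) \<longleftrightarrow> is_sq (x \<ominus> \<one>))"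
    "is_sq (a 2 \<oplus> b 2) \<longleftrightarrow> (is_sq (\<one> \<ominus> l) \<longleftrightarrow> is_sq (x \<ominus> \<one>))"
    "is_sq (a 2 \<oplus> b 3) \<longleftrightarrow> ((is_sq x \<longleftrightarrow> is_sq (\<one> \<ominus> l)) \<longleftrightarrow> is_sq (x \<ominus> \<one>))"
    "is_sq (a 3 \<oplus> b 1) \<longleftrightarrow> ((is_sq l \<longleftrightarrow> is_sq (x \<ominus> \<one>)) \<longleftrightarrow> is_sq (x \<ominus> l))"
    "is_sq (a 3 \<oplus> b 2) \<longleftrightarrow> ((is_sq (\<ominus> \<one>) \<longleftrightarrow> (is_sq x \<longleftrightarrow> is_sq (\<one> \<ominus> l))) \<longleftrightarrow> is_sq (x \<ominus> l))"
    "is_sq (a 3 \<oplus> b 3) \<longleftrightarrow> ((is_sq (\<ominus> \<one>) \<longleftrightarrow> (is_sq l \<longleftrightarrow> is_sq (\<one> \<ominus> l))) \<longleftrightarrow> is_sq (x \<ominus> l))"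
    unfolding val k1[THEN conjunct2] k2[THEN conjunct2] k3[THEN conjunct2] m[THEN conjunct2] m'[THEN conjunct2]
    by (simp_all only: a_minus_def)
  have card3: "card {t \<in> {1, 2, 3::nat}. P t} = 1"
    if "P 1 \<and> \<not> P 2 \<and> \<not> P 3 \<or> \<not> P 1 \<and> P 2 \<and> \<not> P 3 \<or> \<not> P 1 \<and> \<not> P 2 \<and> P 3" for P
  proof -
    have "{t \<in> {1, 2, 3::nat}. P t} = (if P 1 then {1} else if P 2 then {2} else {3})"
      using that by auto
    then show ?thesis by simp
  qed
  have "generalized_hadamard (add_monoid R) (carrier R \<times> {..<4}) (carrier R \<times> {..<4}) (square_matrix a b) 4"
  proof (rule generalized_hadamard_square_matrix)
    fix s s' :: nat assume s: "s < 4" "s' < 4" "s \<noteq> s'"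
    have "card {t \<in> {1..<4}. is_sq (a s \<oplus> b t) \<longleftrightarrow> is_sq (a s' \<oplus> b t)} = 1"
      unfolding set4
    proof (rule card3)
      show "(is_sq (a s \<oplus> b 1) \<longleftrightarrow> is_sq (a s' \<oplus> b 1)) \<and> \<not> (is_sq (a s \<oplus> b 2) \<longleftrightarrow> is_sq (a s' \<oplus> b 2)) \<and>
            \<not> (is_sq (a s \<oplus> b 3) \<longleftrightarrow> is_sq (a s' \<oplus> b 3)) \<or>
          \<not> (is_sq (a s \<oplus> b 1) \<longleftrightarrow> is_sq (a s' \<oplus> b 1)) \<and> (is_sq (a s \<oplus> b 2) \<longleftrightarrow> is_sq (a s' \<oplus> b 2)) \<and>
            \<not> (is_sq (a s \<oplus> b 3) \<longleftrightarrow> is_sq (a s' \<oplus> b 3)) \<or>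
          \<not> (is_sq (a s \<oplus> b 1) \<longleftrightarrow> is_sq (a s' \<oplus> b 1)) \<and> \<not> (is_sq (a s \<oplus> b 2) \<longleftrightarrow> is_sq (a s' \<oplus> b 2)) \<and>
            (is_sq (a s \<oplus> b 3) \<longleftrightarrow> is_sq (a s' \<oplus> b 3))"
        \<comment> \<open>After rewriting by \<open>chi\<close> the claim is propositional in the
          characters of \<open>-1, x, x - 1, x - l, l, 1 - l\<close>.\<close>
        using s sq unfolding lt4
        by (elim disjE; simp only: chi; argo)
    qed
    then show "2 * card {t \<in> {1..<4}. is_sq (a s \<oplus> b t) \<longleftrightarrow> is_sq (a s' \<oplus> b t)} + 2 = 4" by simp
  qed (use ac' bc nz in auto)
  then show ?thesis by blast
qed

text \<open>If minus one is a nonsquare, take \<open>l\<close> and \<open>1 - l\<close> nonsquares; otherwise take \<open>x\<close> and \<open>x - 1\<close>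
  squares, \<open>x = ((t + 1/t) / 2)\<^sup>2\<close>, and \<open>l = - s x\<close> with \<open>s\<close> a square and \<open>s + 1\<close> a nonsquare.\<close>
lemma generalized_hadamard_4_exists:
  assumes card: "card (carrier R) > 5"
  shows "\<exists>M. generalized_hadamard (add_monoid R) (carrier R \<times> {..<4::nat}) (carrier R \<times> {..<4::nat}) M 4"
proof -
  have avoid: "\<exists>x\<in>carrier R. x \<notin> set ys" if "length ys \<le> 5" for ys
  proof (rule ccontr)
    assume "\<not> ?thesis"
    then have "card (carrier R) \<le> card (set ys)" by (intro card_mono) auto
    then show False using card card_length[of ys] that by linarith
  qed
  obtain s where s: "s \<in> carrier R" "s \<noteq> \<zero>" "is_sq s" "s \<oplus> \<one> \<noteq> \<zero>" "\<not> is_sq (s \<oplus> \<one>)"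
    using consecutive_square_nonsquare_exists by blast
  have m1: "\<ominus> \<one> \<in> carrier R" "\<ominus> \<one> \<noteq> \<zero>" using one_not_zero by auto
  have neg_s: "\<ominus> s = \<ominus> \<one> \<otimes> s" using s(1) by algebra
  have sq_neg_s: "is_sq (\<ominus> s) \<longleftrightarrow> is_sq (\<ominus> \<one>)"
    unfolding neg_s using is_sq_mult_iff[OF m1 s(1,2)] s(3) by simp
  have neg_s_nz: "\<ominus> s \<noteq> \<zero>" using s by auto
  show ?thesis
  proof (cases "is_sq (\<ominus> \<one>)")
    case False
    \<comment> \<open>With \<open>l = - s\<close>, all of \<open>-1\<close>, \<open>l\<close> and
      \<open>1 - l = s + 1\<close> are nonsquares. This alone refutes the three excluded conditions,
      so \<open>x\<close> only has to avoid the degenerate values.\<close>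
    obtain x where x: "x \<in> carrier R" "x \<noteq> \<zero>" "x \<noteq> \<one>" "x \<noteq> \<ominus> s"
      using avoid[of "[\<zero>, \<one>, \<ominus> s]"] by auto
    have minus: "\<one> \<ominus> \<ominus> s = s \<oplus> \<one>" using s(1) by algebra
    have "\<ominus> s \<noteq> \<one>"
    proof
      assume "\<ominus> s = \<one>"
      then have "s \<oplus> \<one> = \<zero>" using s(1) r_neg[of s] by simp
      then show False using s by simp
    qed
    then show ?thesis
      using generalized_hadamard_4[of x "\<ominus> s"] x s neg_s_nz sq_neg_s False by (simp add: minus)
  next
    case True
    then obtain i where i: "i \<in> carrier R" "\<ominus> \<one> = i \<otimes> i" by (auto simp: is_sq_def)
    \<comment> \<open>Zero has no inverse, \<open>1\<close> and \<open>-1\<close> would give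
      \<open>x = 1\<close>, and \<open>i\<close> and \<open>-i\<close> would give
      \<open>x = 0\<close>.\<close>
    obtain t where t: "t \<in> carrier R" "t \<noteq> \<zero>" "t \<noteq> \<one>" "t \<noteq> \<ominus> \<one>" "t \<noteq> i" "t \<noteq> \<ominus> i"
      using avoid[of "[\<zero>, \<one>, \<ominus> \<one>, i, \<ominus> i]"] by auto
    define t' h where "t' = inv t" and "h = inv (\<one> \<oplus> \<one>)"
    have t': "t' \<in> carrier R" "t \<otimes> t' = \<one>" using t by (simp_all add: t'_def field_Units)
    have h: "h \<in> carrier R" "(\<one> \<oplus> \<one>) \<otimes> h = \<one>"
      using two_nonzero by (simp_all add: h_def field_Units)
    have hnz: "h \<noteq> \<zero>" using h by auto
    \<comment> \<open>Chosen so that \<open>a^2 - c^2 = t t' = 1\<close>: then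
      \<open>x = a^2\<close> and \<open>x - 1 = c^2\<close> are both squares.\<close>
    define a c where "a = (t \<oplus> t') \<otimes> h" and "c = (t \<ominus> t') \<otimes> h"
    have ac: "a \<in> carrier R" "c \<in> carrier R" using t t' h by (auto simp: a_def c_def)
    have "t \<oplus> t' \<noteq> \<zero>"
    proof
      assume *: "t \<oplus> t' = \<zero>"
      have "t \<otimes> t = t \<otimes> (t \<oplus> t') \<ominus> t \<otimes> t'" using t(1) t'(1) by algebra
      also have "\<dots> = i \<otimes> i" unfolding * t'(2) i(2)[symmetric] using t(1) by algebra
      finally show False using square_eq_iff[OF t(1) i(1)] t by simp
    qed
    then have anz: "a \<noteq> \<zero>" using t t' h hnz integral_iff by (simp add: a_def)
    have "t \<ominus> t' \<noteq> \<zero>"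
    proof
      assume *: "t \<ominus> t' = \<zero>"
      have "t \<otimes> t = t \<otimes> (t \<ominus> t') \<oplus> t \<otimes> t'" using t(1) t'(1) by algebra
      also have "\<dots> = \<one> \<otimes> \<one>" unfolding * t'(2) using t(1) by simp
      finally show False using square_eq_iff[OF t(1) one_closed] t by simp
    qed
    then have cnz: "c \<noteq> \<zero>" using t t' h hnz integral_iff by (simp add: c_def)
    define x where "x = a \<otimes> a"
    have x: "x \<in> carrier R" "x \<noteq> \<zero>" "is_sq x" using ac anz integral_iff by (auto simp: x_def is_sq_def)
    have "x \<ominus> c \<otimes> c = ((\<one> \<oplus> \<one>) \<otimes> h) \<otimes> ((\<one> \<oplus> \<one>) \<otimes> h) \<otimes> (t \<otimes> t')"
      unfolding x_def a_def c_def using t(1) t'(1) h(1) by algebra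
    then have xc: "x \<ominus> c \<otimes> c = \<one>" unfolding h(2) t'(2) by simp
    have "x \<ominus> \<one> = c \<otimes> c" unfolding xc[symmetric] using x(1) ac(2) by algebra
    then have x1: "is_sq (x \<ominus> \<one>)" "x \<ominus> \<one> \<noteq> \<zero>"
      using ac(2) cnz integral_iff by (auto simp: is_sq_def)
    \<comment> \<open>Then \<open>x - l = (s + 1) x\<close> is a nonsquare while \<open>-1\<close>,
      \<open>x\<close>, \<open>x - 1\<close> and \<open>l\<close> are squares. This refutes all
      three excluded conditions, whatever the character of \<open>1 - l\<close>.\<close>
    define l where "l = \<ominus> s \<otimes> x"
    have l: "l \<in> carrier R" "l \<noteq> \<zero>" "is_sq l"
      using s x neg_s_nz integral_iff is_sq_mult_iff[of "\<ominus> s" x] sq_neg_s True by (auto simp: l_def)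
    have "x \<ominus> l = (s \<oplus> \<one>) \<otimes> x" unfolding l_def using s(1) x(1) by algebra
    then have xl: "\<not> is_sq (x \<ominus> l)" "x \<ominus> l \<noteq> \<zero>"
      using s x integral_iff is_sq_mult_iff[of "s \<oplus> \<one>" x] by auto
    have "x \<noteq> l" "l \<noteq> \<one>" "x \<noteq> \<one>" using xl x1 x l by auto
    then show ?thesis
      using generalized_hadamard_4[of x l] x l xl x1 True by simp
  qed
qed

end

section \<open>Orders three and five\<close>

text \<open>The hypotheses are phrased executably, so that a concrete table can be checked by
  evaluation. Testing each pair of rows in list order suffices: the opposite order negates the
  differences, which permutes the residues.\<close>

lemma generalized_hadamard_of_table:
  fixes T :: "int list list" and p k :: nat
  assumes p: "p \<ge> 2" and len: "length T = k * p"
    and rows: "list_all (\<lambda>r. length r = k * p \<and> list_all (\<lambda>a. 0 \<le> a \<and> a < int p) r) T"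
    and diff: "sorted_wrt (\<lambda>r r'. list_all (\<lambda>g.
      length (filter (\<lambda>d. d = g) (map2 (\<lambda>a b. (a - b) mod int p) r r')) = k) [0..int p - 1]) T"
  shows "generalized_hadamard (add_monoid (residue_ring (int p))) {..<k * p} {..<k * p}
    (\<lambda>i j. T ! i ! j) k"
proof -
  interpret residues "int p" "residue_ring (int p)" using p by (simp add: residues_def)
  have row: "length (T ! i) = k * p" "\<And>j. j < k * p \<Longrightarrow> 0 \<le> T ! i ! j \<and> T ! i ! j < int p"
    if "i < k * p" for i
    using rows that len by (auto simp: list_all_length)
  have less: "card {j. j < k * p \<and> (T ! i ! j - T ! i' ! j) mod int p = g} = k"
    if "i < i'" "i' < k * p" "0 \<le> g" "g < int p" for i i' g
  proof -
    have "g \<in> set [0..int p - 1]" using that by simp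
    then have "length (filter (\<lambda>d. d = g) (map2 (\<lambda>a b. (a - b) mod int p) (T ! i) (T ! i'))) = k"
      using sorted_wrt_nth_less[OF diff that(1)] that(2) len unfolding list_all_iff by simp
    then show ?thesis
      using row that by (simp add: length_filter_conv_card cong: conj_cong)
  qed
  have "card {j \<in> {..<k * p}. T ! i ! j = (g + T ! i' ! j) mod int p} = k"
    if i: "i < k * p" "i' < k * p" "i \<noteq> i'" and g: "0 \<le> g" "g < int p" for i i' g
  proof (cases "i < i'")
    case True
    have "T ! i ! j = (g + T ! i' ! j) mod int p \<longleftrightarrow> (T ! i ! j - T ! i' ! j) mod int p = g"
      if "j < k * p" for j
    proof -
      define a b where "a = T ! i ! j" and "b = T ! i' ! j"
      have "a mod int p = a" "g mod int p = g" using row(2)[OF i(1) that] g by (simp_all add: a_def)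
      then have "a = (g + b) mod int p \<longleftrightarrow> (a - b) mod int p = g"
        by (metis add_diff_cancel_right' diff_add_cancel mod_add_left_eq mod_diff_left_eq)
      then show ?thesis by (simp add: a_def b_def)
    qed
    then have "{j \<in> {..<k * p}. T ! i ! j = (g + T ! i' ! j) mod int p}
        = {j. j < k * p \<and> (T ! i ! j - T ! i' ! j) mod int p = g}" by auto
    then show ?thesis using less[OF True i(2) g] by simp
  next
    case False
    then have lt: "i' < i" using i by simp
    have "T ! i ! j = (g + T ! i' ! j) mod int p \<longleftrightarrow> (T ! i' ! j - T ! i ! j) mod int p = (- g) mod int p"
      if "j < k * p" for j
    proof -
      define a b where "a = T ! i ! j" and "b = T ! i' ! j"
      have "a mod int p = a" using row(2)[OF i(1) that] by (simp add: a_def)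
      then have "a = (g + b) mod int p \<longleftrightarrow> [a = g + b] (mod int p)" by (simp add: cong_def)
      also have "\<dots> \<longleftrightarrow> [b - a = - g] (mod int p)"
        by (simp add: cong_iff_dvd_diff algebra_simps dvd_diff_commute)
      finally show ?thesis by (simp add: a_def b_def cong_def)
    qed
    then have "{j \<in> {..<k * p}. T ! i ! j = (g + T ! i' ! j) mod int p}
        = {j. j < k * p \<and> (T ! i' ! j - T ! i ! j) mod int p = (- g) mod int p}" by auto
    then show ?thesis using less[OF lt i(1), of "(- g) mod int p"] p by simp
  qed
  then show ?thesis
    using row p by (auto simp: generalized_hadamard_def res_carrier_eq res_add_eq)
qed

text \<open>Found by computer search: row \<open>4 x + s\<close>, column \<open>4 y + t\<close> contains a quadratic polynomial in
  \<open>x - y\<close> that depends on \<open>s, t\<close> only.\<close>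
definition hadamard_table_3 :: "int list list" where
  "hadamard_table_3 =
   [[0,0,0,0,2,2,1,1,0,2,0,0],
    [0,1,1,2,1,1,2,0,0,2,1,0],
    [0,1,2,1,0,1,0,1,1,2,0,2],
    [0,2,1,1,2,2,2,1,2,1,1,2],
    [0,2,0,0,0,0,0,0,2,2,1,1],
    [0,2,1,0,0,1,1,2,1,1,2,0],
    [1,2,0,2,0,1,2,1,0,1,0,1],
    [2,1,1,2,0,2,1,1,2,2,2,1],
    [2,2,1,1,0,2,0,0,0,0,0,0],
    [1,1,2,0,0,2,1,0,0,1,1,2],
    [0,1,0,1,1,2,0,2,0,1,2,1],
    [2,2,2,1,2,1,1,2,0,2,1,1]]"

text \<open>Found by computer search: row \<open>4 x + s\<close>, column \<open>4 y + t\<close> contains a quadratic form in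
  \<open>x, y\<close> that depends on \<open>s, t\<close> only.\<close>
definition hadamard_table_5 :: "int list list" where
  "hadamard_table_5 =
   [[0,0,0,0,0,0,0,0,0,0,0,0,0,0,0,0,0,0,0,0],
    [0,0,0,0,2,1,3,1,3,4,2,4,3,4,2,4,2,1,3,1],
    [0,0,0,0,1,3,2,4,4,2,3,1,4,2,3,1,1,3,2,4],
    [0,0,0,0,4,2,4,3,1,3,1,2,1,3,1,2,4,2,4,3],
    [0,1,2,3,1,2,3,4,2,3,4,0,3,4,0,1,4,0,1,2],
    [0,1,3,4,3,4,2,3,0,4,2,4,1,1,3,2,1,0,0,2],
    [0,2,1,3,3,1,2,0,3,1,2,0,0,2,1,3,4,4,4,4],
    [0,3,1,4,1,3,1,1,0,2,4,4,2,0,0,3,2,2,4,3],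
    [0,4,3,2,2,1,0,4,4,3,2,1,1,0,4,3,3,2,1,0],
    [0,4,2,1,4,4,2,3,2,1,3,2,4,0,0,3,0,1,3,1],
    [0,3,4,2,0,3,4,2,2,4,3,0,1,1,1,1,2,4,3,0],
    [0,2,4,1,3,0,0,2,4,2,4,4,3,3,1,2,0,3,1,1],
    [0,4,3,2,3,2,1,0,1,0,4,3,4,3,2,1,2,1,0,4],
    [0,4,2,1,0,1,3,1,4,0,0,3,2,1,3,2,4,4,2,3],
    [0,3,4,2,2,4,3,0,1,1,1,1,2,4,3,0,0,3,4,2],
    [0,2,4,1,0,3,1,1,3,3,1,2,4,2,4,4,3,0,0,2],
    [0,1,2,3,4,0,1,2,3,4,0,1,2,3,4,0,1,2,3,4],
    [0,1,3,4,1,0,0,2,1,1,3,2,0,4,2,4,3,4,2,3],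
    [0,2,1,3,4,4,4,4,0,2,1,3,3,1,2,0,3,1,2,0],
    [0,3,1,4,2,2,4,3,2,0,0,3,0,2,4,4,1,3,1,1]]"

lemma generalized_hadamard_table_3:
  "generalized_hadamard (add_monoid (residue_ring (int 3))) {..<4 * 3} {..<4 * 3}
    (\<lambda>i j. hadamard_table_3 ! i ! j) 4"
  by (rule generalized_hadamard_of_table) (code_simp+)

lemma generalized_hadamard_table_5:
  "generalized_hadamard (add_monoid (residue_ring (int 5))) {..<4 * 5} {..<4 * 5}
    (\<lambda>i j. hadamard_table_5 ! i ! j) 4"
  by (rule generalized_hadamard_of_table) (code_simp+)

section \<open>Assembling the cases\<close>

lemma (in cring) additive_generalized_hadamard_imp_full_PAB:
  assumes "generalized_hadamard (add_monoid R) I J M k" and "k \<ge> 1"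
    and "card (carrier R) = q" and "q \<ge> 2"
  shows "\<exists>Ns. full_PAB (k * q) k (k - 1) Ns"
  using add.generalized_hadamard_imp_full_PAB[OF assms(1,2), of q] assms(3,4) by simp

theorem corollary4p4:
  fixes q :: nat
  assumes "primepow q" and "q \<ge> 2"
  shows "(\<exists>Ns. full_PAB (2 * q) 2 1 Ns) \<and> (\<exists>Ns. full_PAB (4 * q) 4 3 Ns)"
proof (cases "even q")
  case True
  obtain p n where p: "Factorial_Ring.prime p" "n > 0" "q = p ^ n"
    using assms(1) unfolding primepow_def by auto
  then have "2 dvd p" using True by (metis even_power)
  then have "p = 2" using p(1) two_is_prime_nat by (metis primes_dvd_imp_eq)
  then show ?thesis
    using full_PAB_prime_power_multiple[of 2 2 1 q n] full_PAB_prime_power_multiple[of 2 4 2 q n] p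
    by simp
next
  case False
  obtain F :: "(((int list \<times> nat) multiset) \<Rightarrow> int) ring"
    where F: "field F" "finite (carrier F)" "card (carrier F) = q"
    using finite_field_exists[OF assms(1)] by blast
  interpret field F by (rule F)
  interpret finite_odd_field F
  proof
    show "finite (carrier F)" by (rule F)
    show "\<one>\<^bsub>F\<^esub> \<oplus>\<^bsub>F\<^esub> \<one>\<^bsub>F\<^esub> \<noteq> \<zero>\<^bsub>F\<^esub>"
    proof
      assume two: "\<one>\<^bsub>F\<^esub> \<oplus>\<^bsub>F\<^esub> \<one>\<^bsub>F\<^esub> = \<zero>\<^bsub>F\<^esub>"
      \<comment> \<open>If two were zero, the odd multiple \<open>q\<close> of one would be one; but
        it is zero, as \<open>q\<close> is the order of the additive group.\<close>
      obtain m where m: "q = Suc (2 * m)" using False by (auto elim: oddE)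
      have "[(2 * m)] \<cdot>\<^bsub>F\<^esub> \<one>\<^bsub>F\<^esub> = [m] \<cdot>\<^bsub>F\<^esub> ([(2::nat)] \<cdot>\<^bsub>F\<^esub> \<one>\<^bsub>F\<^esub>)"
        using add.nat_pow_pow[of "\<one>\<^bsub>F\<^esub>" m 2] by simp
      also have "[(2::nat)] \<cdot>\<^bsub>F\<^esub> \<one>\<^bsub>F\<^esub> = \<zero>\<^bsub>F\<^esub>"
        using two by (simp add: add_pow_def numeral_2_eq_2)
      finally have "[q] \<cdot>\<^bsub>F\<^esub> \<one>\<^bsub>F\<^esub> = \<one>\<^bsub>F\<^esub>" by (simp add: m)
      moreover have "[q] \<cdot>\<^bsub>F\<^esub> \<one>\<^bsub>F\<^esub> = \<zero>\<^bsub>F\<^esub>"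
        using add.pow_order_eq_1[of "\<one>\<^bsub>F\<^esub>"] F by (simp add: add_pow_def order_def)
      ultimately show False using one_not_zero by simp
    qed
  qed
  have "\<exists>Ns. full_PAB (2 * q) 2 (2 - 1) Ns"
    using generalized_hadamard_2_exists additive_generalized_hadamard_imp_full_PAB F(3) assms(2)
    by fastforce
  moreover have "\<exists>Ns. full_PAB (4 * q) 4 (4 - 1) Ns"
  proof -
    have "q > 5 \<or> q = 3 \<or> q = 5"
    proof -
      have "q \<in> {2, 3, 4, 5} \<or> q > 5" using assms(2) by auto
      then show ?thesis using False by auto
    qed
    then consider "q > 5" | "q = 3" | "q = 5" by blast
    then show ?thesis
    proof cases
      case 1
      then show ?thesis
        using generalized_hadamard_4_exists additive_generalized_hadamard_imp_full_PAB F(3) assms(2)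
        by fastforce
    next
      case 2
      \<comment> \<open>The table has integer entries, so it lives over the concrete ring of
        residues and not over the abstract field \<open>F\<close>.\<close>
      interpret Z: residues "int 3" "residue_ring (int 3)" by (simp add: residues_def)
      show ?thesis
        using Z.additive_generalized_hadamard_imp_full_PAB[OF generalized_hadamard_table_3, of q] 2
        by (simp add: Z.res_carrier_eq[simplified])
    next
      case 3
      interpret Z: residues "int 5" "residue_ring (int 5)" by (simp add: residues_def)
      show ?thesis
        using Z.additive_generalized_hadamard_imp_full_PAB[OF generalized_hadamard_table_5, of q] 3
        by (simp add: Z.res_carrier_eq[simplified])
    qed
  qed
  ultimately show ?thesis by simp
qed

end
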